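(* Let $q\in\mathbb{C}$ with $0<|q|<1$. Let $f$ be holomorphic in $|z|<R$, where $R>1$, let $a,b,c\in\mathbb{C}$ be such that no denominator below vanishes, and assume \[ \left|\frac{c}{ab}\right|<R. \] Then \[ \sum_{n=0}^{\infty}\frac{(a,b;q)_n}{(c,q;q)_n}\left(\frac{c}{ab}\right)^n\sum_{k=0}^n\frac{(q^{-n};q)_k}{(q;q)_k}f(q^k)q^k =\frac{(a,b,c/a,c/b;q)_\infty}{(q,abq/c,c/ab,c;q)_\infty}\int_{c/ab}^1\frac{(tq,abtq/c;q)_\infty}{(at,bt;q)_\infty}f(t)\,d_qt . \] For fixed $f$, both sides are meromorphic in $a,b,c$ on the region $|c/ab|<R$, away from their poles.
   Context: For $a\in\mathbb{C}$ and $n\in\{0,1,2,\ldots\}\cup\{\infty\}$, $(a;q)_n=\prod_{j=0}^{n-1}(1-aq^j)$ and $(a_1,\ldots,a_r;q)_n=\prod_{i=1}^r(a_i;q)_n$. The Jackson $q$-integral (without the conventional factor $1-q$) is \[ \int_u^v g(t)\,d_qt:=\sum_{n=0}^{\infty}\bigl(vq^n g(vq^n)-uq^n g(uq^n)\bigr), \] whenever the series converges. Expressions such as $c/ab$ mean $c/(ab)$. Double sums are understood as iterated sums, with the terminating inner sum evaluated first. *)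

theory Defs
  imports "HOL-Analysis.Analysis"
begin

definition qpoch :: "complex \<Rightarrow> complex \<Rightarrow> nat \<Rightarrow> complex" where
  "qpoch a q n = (\<Prod>j<n. 1 - a * q ^ j)"

definition qpoch_inf :: "complex \<Rightarrow> complex \<Rightarrow> complex" where
  "qpoch_inf a q = (\<Prod>j. 1 - a * q ^ j)"

text \<open>The multi-parameter symbols $(a_1,\ldots,a_r;q)_n$ and $(a_1,\ldots,a_r;q)_\infty$.\<close>

definition qpochs :: "complex list \<Rightarrow> complex \<Rightarrow> nat \<Rightarrow> complex" where
  "qpochs as q n = (\<Prod>a\<leftarrow>as. qpoch a q n)"

definition qpochs_inf :: "complex list \<Rightarrow> complex \<Rightarrow> complex" where
  "qpochs_inf as q = (\<Prod>a\<leftarrow>as. qpoch_inf a q)"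

text \<open>The Jackson integral is normalised without the conventional factor $1-q$.\<close>

definition jackson_term ::
  "complex \<Rightarrow> complex \<Rightarrow> complex \<Rightarrow> (complex \<Rightarrow> complex) \<Rightarrow> nat \<Rightarrow> complex" where
  "jackson_term q u v g n = v * q ^ n * g (v * q ^ n) - u * q ^ n * g (u * q ^ n)"

definition jackson_integrable ::
  "complex \<Rightarrow> complex \<Rightarrow> complex \<Rightarrow> (complex \<Rightarrow> complex) \<Rightarrow> bool" where
  "jackson_integrable q u v g \<longleftrightarrow> summable (jackson_term q u v g)"

definition jackson_integral ::
  "complex \<Rightarrow> complex \<Rightarrow> complex \<Rightarrow> (complex \<Rightarrow> complex) \<Rightarrow> complex" where
  "jackson_integral q u v g = (\<Sum>n. jackson_term q u v g n)"

definition lhs_term ::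
  "complex \<Rightarrow> (complex \<Rightarrow> complex) \<Rightarrow> complex \<Rightarrow> complex \<Rightarrow> complex \<Rightarrow> nat \<Rightarrow> complex" where
  "lhs_term q f a b c n =
     qpochs [a, b] q n / qpochs [c, q] q n * (c / (a * b)) ^ n *
     (\<Sum>k\<le>n. qpoch (q powi (- int n)) q k / qpoch q q k * f (q ^ k) * q ^ k)"

definition rhs_integrand ::
  "complex \<Rightarrow> (complex \<Rightarrow> complex) \<Rightarrow> complex \<Rightarrow> complex \<Rightarrow> complex \<Rightarrow> complex \<Rightarrow> complex" where
  "rhs_integrand q f a b c t =
     qpochs_inf [t * q, a * b * t * q / c] q / qpochs_inf [a * t, b * t] q * f t"

definition rhs ::
  "complex \<Rightarrow> (complex \<Rightarrow> complex) \<Rightarrow> complex \<Rightarrow> complex \<Rightarrow> complex \<Rightarrow> complex" where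
  "rhs q f a b c =
     qpochs_inf [a, b, c / a, c / b] q / qpochs_inf [q, a * b * q / c, c / (a * b), c] q *
     jackson_integral q (c / (a * b)) 1 (rhs_integrand q f a b c)"

definition param_region :: "real \<Rightarrow> (complex \<times> complex \<times> complex) set" where
  "param_region R = {(a, b, c). a \<noteq> 0 \<and> b \<noteq> 0 \<and> norm (c / (a * b)) < R}"

text \<open>The parameters for which no denominator of the left-hand side, respectively of the
  right-hand side, vanishes. The integrand is only evaluated at $t = q^n$ and
  $t = (c/ab)q^n$. The value $c = 0$ is excluded on the right because of $abq/c$.\<close>

definition lhs_domain :: "complex \<Rightarrow> real \<Rightarrow> (complex \<times> complex \<times> complex) set" where
  "lhs_domain q R = {(a, b, c). (a, b, c) \<in> param_region R \<and> (\<forall>n. qpochs [c, q] q n \<noteq> 0)}"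

definition rhs_domain :: "complex \<Rightarrow> real \<Rightarrow> (complex \<times> complex \<times> complex) set" where
  "rhs_domain q R = {(a, b, c). (a, b, c) \<in> param_region R \<and> c \<noteq> 0 \<and>
     qpochs_inf [q, a * b * q / c, c / (a * b), c] q \<noteq> 0 \<and>
     (\<forall>n. \<forall>t\<in>{q ^ n, c / (a * b) * q ^ n}. qpochs_inf [a * t, b * t] q \<noteq> 0)}"

text \<open>Holomorphy in three variables: complex (Frechet) differentiability at every point. It is
  meant for open sets.\<close>

definition holomorphic3_on ::
  "(complex \<times> complex \<times> complex \<Rightarrow> complex) \<Rightarrow> (complex \<times> complex \<times> complex) set \<Rightarrow> bool" where
  "holomorphic3_on F U \<longleftrightarrow>
     (\<forall>p\<in>U. \<exists>A B C. (F has_derivative (\<lambda>(x, y, z). A * x + B * y + C * z)) (at p))"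

text \<open>A function \<open>F\<close>, defined on a dense open subset \<open>S\<close> of \<open>D\<close>, is a meromorphic
  function on \<open>D\<close>: it is holomorphic on \<open>S\<close>, and near every point of \<open>D\<close>, including those
  outside \<open>S\<close>, it is a quotient of two holomorphic functions. The values of \<open>F\<close> outside
  \<open>S\<close> (in HOL determined by division by zero) play no role.\<close>

definition meromorphic3_on ::
  "(complex \<times> complex \<times> complex \<Rightarrow> complex) \<Rightarrow> (complex \<times> complex \<times> complex) set \<Rightarrow>
   (complex \<times> complex \<times> complex) set \<Rightarrow> bool" where
  "meromorphic3_on F S D \<longleftrightarrow>
     open D \<and> open S \<and> S \<subseteq> D \<and> D \<subseteq> closure S \<and> holomorphic3_on F S \<and>
     (\<forall>p\<in>D. \<exists>U G H. open U \<and> connected U \<and> p \<in> U \<and> U \<subseteq> D \<and>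
        holomorphic3_on G U \<and> holomorphic3_on H U \<and> (\<exists>w\<in>U. H w \<noteq> 0) \<and>
        (\<forall>w\<in>U \<inter> S. H w \<noteq> 0 \<longrightarrow> F w = G w / H w))"

end

theory Submission
  imports Defs "HOL-Complex_Analysis.Complex_Analysis"
begin

text \<open>
  Put $x = c/(ab)$ and let $W$ be the integrand of the right-hand side without the factor $f$. Both
  sides are linear in $f$, so consider first $f(t) = t^m$. By the $q$-binomial theorem the inner sum
  is then $(q;q)_m/(q;q)_{m-n}$, or 0 for $n > m$ (\<open>inner_sum_power\<close>). Divided by $(q;q)_n$, these
  numbers are the Gaussian binomial coefficients, which are also the coefficients of $t^m$ in the
  Newton basis $N_n(t) = \<Prod>_{i<n} (t - q^i)$ (\<open>power_newton_expansion\<close>). Hence the identity says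
  that the moments of $W$ against $N_n$ are
  $\<integral> W N_n = (\<integral> W) (a,b;q)_n x^n / (c;q)_n$,
  with all integrals from $x$ to 1, together with the value of the total mass $\<integral> W$.

  The ratio of consecutive moments is found by telescoping: a suitable combination of $tW N_{n+1}$
  and $tW N_n$ is a $q$-difference $V(t) - V(tq)$ with $V(1) = V(x) = 0$ (\<open>newton_moment_step\<close>). Its
  case $n = 0$ also tells how $\<integral> W$ changes under $a \<rightarrow> aq$. Iterating this in $a$ and $b$ leads to
  $a = b = 0$, and the constant there is read off from the choice $a = q$, $b = q/x$, for which
  $W = 1$ at all nodes. The result is the Andrews--Askey integral (\<open>andrews_askey\<close>).

  For general $f$ with Taylor coefficients $f_m$ choose $\<rho>$ with $\<rho> \<ge> 1$ and $|x| < \<rho> < R$.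
  Up to a constant, the terms of the double series on the left are at most $|x|^n |f_m| \<le> (|x|/\<rho>)^n |f_m| \<rho>^m$, since
  only $n \<le> m$ contributes. The double series on the right is dominated in a similar way, so
  the identity follows from the one for monomials (\<open>lhs_sums_rhs\<close>).

  The same estimate is locally uniform in $(a,b,c)$. After multiplication by $(c;q)_\<infinity>$ the left-hand
  side is therefore a series of holomorphic functions which converges locally uniformly on the
  region $|c/ab| < R$, and so the left-hand side is a quotient of two functions holomorphic there.
  The right-hand side coincides with it on a dense open set and hence is represented by the same
  quotient, even near $c = 0$ (\<open>meromorphic_lhs_on\<close>).
\<close>

section \<open>The q-shifted factorial\<close>

locale q_base =
  fixes q :: complex
  assumes q_pos: "0 < norm q" and q_less_1: "norm q < 1"
begin

lemma q_nonzero: "q \<noteq> 0"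
  using q_pos by auto

lemma qpoch_0 [simp]: "qpoch z q 0 = 1"
  by (simp add: qpoch_def)

lemma qpoch_Suc: "qpoch z q (Suc n) = qpoch z q n * (1 - z * q ^ n)"
  by (simp add: qpoch_def)

lemma qpoch_add: "qpoch z q (n + k) = qpoch z q n * qpoch (z * q ^ n) q k"
  by (induction k) (simp_all add: qpoch_Suc power_add mult_ac)

lemma qpoch_Suc_shift: "qpoch z q (Suc n) = (1 - z) * qpoch (z * q) q n"
  using qpoch_add[of z 1 n] by (simp add: qpoch_Suc)

text \<open>The bound does not depend on $n$, so it passes to the infinite product. Its uniformity in $z$ on
  bounded sets is what makes the series below converge locally uniformly in the parameters.\<close>

lemma norm_qpoch_le: "norm (qpoch z q n) \<le> exp (norm z / (1 - norm q))"
proof -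
  have "norm (qpoch z q n) = (\<Prod>j<n. norm (1 - z * q ^ j))"
    by (simp add: qpoch_def prod_norm)
  also have "\<dots> \<le> (\<Prod>j<n. exp (norm z * norm q ^ j))"
  proof (intro prod_mono conjI)
    fix j
    have "norm (1 - z * q ^ j) \<le> 1 + norm z * norm q ^ j"
      using norm_triangle_ineq4[of 1 "z * q ^ j"] by (simp add: norm_mult norm_power)
    also have "\<dots> \<le> exp (norm z * norm q ^ j)" by (rule exp_ge_add_one_self)
    finally show "norm (1 - z * q ^ j) \<le> exp (norm z * norm q ^ j)" .
  qed simp
  also have "\<dots> = exp (norm z * (\<Sum>j<n. norm q ^ j))"
    by (simp add: exp_sum sum_distrib_left)
  also have "(\<Sum>j<n. norm q ^ j) \<le> (\<Sum>j. norm q ^ j)"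
    using q_less_1 by (intro sum_le_suminf summable_geometric) auto
  also have "(\<Sum>j. norm q ^ j) = 1 / (1 - norm q)"
    using q_less_1 by (intro suminf_geometric) auto
  finally show ?thesis by (simp add: mult_left_mono)
qed

lemma convergent_prod_qpoch: "convergent_prod (\<lambda>j. 1 - z * q ^ j)"
proof -
  have "summable (\<lambda>j. norm (1 - z * q ^ j - 1))"
    using q_less_1 by (simp add: norm_mult norm_power summable_mult summable_geometric)
  then show ?thesis
    using abs_convergent_prod_conv_summable abs_convergent_prod_imp_convergent_prod by blast
qed

lemma qpoch_LIMSEQ: "(\<lambda>n. qpoch z q n) \<longlonglongrightarrow> qpoch_inf z q"
  using convergent_prod_LIMSEQ[OF convergent_prod_qpoch[of z]]
  by (simp add: qpoch_def qpoch_inf_def LIMSEQ_lessThan_iff_atMost)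

lemma norm_qpoch_inf_le: "norm (qpoch_inf z q) \<le> exp (norm z / (1 - norm q))"
  by (rule LIMSEQ_le_const2[OF tendsto_norm[OF qpoch_LIMSEQ]]) (use norm_qpoch_le in blast)

text \<open>Comparing the partial products instead of the infinite ones avoids a case distinction on whether
  some factor vanishes.\<close>

lemma qpoch_inf_split: "qpoch_inf z q = qpoch z q n * qpoch_inf (z * q ^ n) q"
proof (rule LIMSEQ_unique)
  show "(\<lambda>k. qpoch z q (n + k)) \<longlonglongrightarrow> qpoch_inf z q"
    using LIMSEQ_ignore_initial_segment[OF qpoch_LIMSEQ[of z], of n] by (simp add: add.commute)
  show "(\<lambda>k. qpoch z q (n + k)) \<longlonglongrightarrow> qpoch z q n * qpoch_inf (z * q ^ n) q"
    unfolding qpoch_add by (intro tendsto_intros qpoch_LIMSEQ)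
qed

lemma qpoch_inf_shift: "qpoch_inf z q = (1 - z) * qpoch_inf (z * q) q"
  using qpoch_inf_split[of z 1] by (simp add: qpoch_Suc)

lemma qpoch_inf_eq_0_iff: "qpoch_inf z q = 0 \<longleftrightarrow> (\<exists>j. z * q ^ j = 1)"
proof
  assume "qpoch_inf z q = 0"
  then show "\<exists>j. z * q ^ j = 1"
    using prodinf_nonzero[OF convergent_prod_qpoch[of z]] unfolding qpoch_inf_def by force
next
  assume "\<exists>j. z * q ^ j = 1"
  then obtain j where "z * q ^ j = 1" by blast
  then show "qpoch_inf z q = 0"
    using qpoch_inf_split[of z "Suc j"] by (simp add: qpoch_Suc)
qed

lemma qpoch_eq_0_iff: "qpoch z q n = 0 \<longleftrightarrow> (\<exists>j<n. z * q ^ j = 1)"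
  by (auto simp: qpoch_def)

lemma qpoch_inf_1 [simp]: "qpoch_inf 1 q = 0"
  by (auto simp: qpoch_inf_eq_0_iff intro: exI[of _ 0])

lemma qpoch_inf_0 [simp]: "qpoch_inf 0 q = 1"
  by (simp add: qpoch_inf_def)

lemma qpoch_inf_power_nonzero: "qpoch_inf z q \<noteq> 0 \<Longrightarrow> qpoch_inf (z * q ^ n) q \<noteq> 0"
  using qpoch_inf_split[of z n] by auto

lemma qpoch_nonzero: "qpoch_inf z q \<noteq> 0 \<Longrightarrow> qpoch z q n \<noteq> 0"
  using qpoch_inf_split[of z n] by auto

lemma qpoch_inf_q_nonzero [simp]: "qpoch_inf q q \<noteq> 0"
proof
  assume "qpoch_inf q q = 0"
  then obtain j where "q * q ^ j = 1" using qpoch_inf_eq_0_iff by blast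
  then have "q ^ Suc j = 1" by simp
  then have "norm q ^ Suc j = 1" by (metis norm_one norm_power)
  moreover have "norm q ^ Suc j < 1" using q_less_1 q_pos by (intro power_Suc_less_one)
  ultimately show False by simp
qed

lemma qpoch_q_nonzero [simp]: "qpoch q q n \<noteq> 0"
  by (simp add: qpoch_nonzero)

text \<open>The partial products converge uniformly on discs, by comparison with a geometric series.\<close>

lemma qpoch_inf_holomorphic: "(\<lambda>z. qpoch_inf z q) holomorphic_on A"
proof (rule holomorphic_on_subset)
  have unif: "uniform_limit (cball 0 r) (\<lambda>n z. qpoch z q n) (\<lambda>z. qpoch_inf z q) sequentially" for r
  proof -
    have "uniformly_convergent_on (cball 0 r) (\<lambda>n z. \<Prod>j<n. 1 - z * q ^ j)"
    proof (rule uniformly_convergent_on_prod')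
      show "uniformly_convergent_on (cball 0 r) (\<lambda>n z. \<Sum>j<n. norm (1 - z * q ^ j - 1))"
      proof (rule Weierstrass_m_test')
        show "norm (norm (1 - z * q ^ j - 1)) \<le> r * norm q ^ j" if "z \<in> cball 0 r" for j z
          using that by (simp add: norm_mult norm_power mult_right_mono)
        show "summable (\<lambda>j. r * norm q ^ j)"
          using q_less_1 by (intro summable_mult summable_geometric) auto
      qed
    qed (auto intro!: continuous_intros)
    then obtain g where g: "uniform_limit (cball 0 r) (\<lambda>n z. qpoch z q n) g sequentially"
      unfolding qpoch_def uniformly_convergent_on_def by blast
    have "g z = qpoch_inf z q" if "z \<in> cball 0 r" for z
      using LIMSEQ_unique tendsto_uniform_limitI[OF g that] qpoch_LIMSEQ by blast
    then show ?thesis by (intro iffD1[OF uniform_limit_cong' g]) auto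
  qed
  show "(\<lambda>z. qpoch_inf z q) holomorphic_on UNIV"
  proof (rule holomorphic_uniform_sequence)
    show "(\<lambda>z. qpoch z q n) holomorphic_on UNIV" for n
      unfolding qpoch_def by (intro holomorphic_intros)
    fix z :: complex
    have "uniform_limit (cball z 1) (\<lambda>n z. qpoch z q n) (\<lambda>z. qpoch_inf z q) sequentially"
      by (rule uniform_limit_on_subset[OF unif[of "norm z + 1"]]) (simp add: cball_subset_cball_iff)
    then show "\<exists>d>0. cball z d \<subseteq> UNIV \<and>
        uniform_limit (cball z d) (\<lambda>n z. qpoch z q n) (\<lambda>z. qpoch_inf z q) sequentially"
      by (intro exI[of _ 1]) auto
  qed simp
qed simp

lemma qpoch_inf_isCont: "isCont (\<lambda>z. qpoch_inf z q) z"
  using holomorphic_on_imp_continuous_on[OF qpoch_inf_holomorphic[of UNIV]]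
  by (simp add: continuous_on_eq_continuous_at)

lemmas continuous_qpoch_inf [continuous_intros] =
  continuous_on_compose2[OF holomorphic_on_imp_continuous_on[OF qpoch_inf_holomorphic[of UNIV]] _ subset_UNIV]

lemma power_q_LIMSEQ: "(\<lambda>n. z * q ^ n) \<longlonglongrightarrow> 0"
  using tendsto_mult_right_zero[OF LIMSEQ_power_zero[OF q_less_1]] .

lemma qpoch_inf_power_LIMSEQ: "(\<lambda>n. qpoch_inf (z * q ^ n) q) \<longlonglongrightarrow> 1"
  using isCont_tendsto_compose[OF qpoch_inf_isCont[of 0] power_q_LIMSEQ[of z]] by simp

text \<open>The factors $(zq^n;q)_\<infinity>$ tend to 1 and none of them vanishes, so they stay away from 0. This
  bounds the denominator of the weight at all nodes of the Jackson integral at once.\<close>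

lemma inverse_qpoch_inf_power_bounded:
  assumes "qpoch_inf z q \<noteq> 0"
  obtains C where "0 < C" "\<And>n. norm (inverse (qpoch_inf (z * q ^ n) q)) \<le> C"
proof -
  have "(\<lambda>n. inverse (qpoch_inf (z * q ^ n) q)) \<longlonglongrightarrow> inverse 1"
    by (intro tendsto_inverse qpoch_inf_power_LIMSEQ) simp
  then show thesis
    using that Bseq_def convergentI convergent_imp_Bseq by metis
qed

lemma inverse_qpoch_bounded:
  assumes "qpoch_inf z q \<noteq> 0"
  obtains C where "0 < C" "\<And>n. norm (inverse (qpoch z q n)) \<le> C"
proof -
  have "(\<lambda>n. inverse (qpoch z q n)) \<longlonglongrightarrow> inverse (qpoch_inf z q)"
    by (intro tendsto_inverse qpoch_LIMSEQ assms)
  then show thesis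
    using that Bseq_def convergentI convergent_imp_Bseq by metis
qed

section \<open>The q-binomial theorem and Newton interpolation at the powers of q\<close>

text \<open>The quotient $(q;q)_m/(q;q)_{m-n}$ for $n \<le> m$, a $q$-analogue of the falling factorial. The
  truncated subtraction makes the factor with $i = m$ vanish, so the value is 0 for $n > m$, as
  the formulas below require.\<close>

definition q_falling :: "nat \<Rightarrow> nat \<Rightarrow> complex" where
  "q_falling m n = (\<Prod>i<n. 1 - q ^ (m - i))"

lemma q_falling_0 [simp]: "q_falling m 0 = 1"
  by (simp add: q_falling_def)

lemma q_falling_Suc: "q_falling m (Suc n) = q_falling m n * (1 - q ^ (m - n))"
  by (simp add: q_falling_def)

lemma q_falling_Suc_Suc: "q_falling (Suc m) (Suc n) = (1 - q ^ Suc m) * q_falling m n"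
  unfolding q_falling_def by (subst prod.lessThan_Suc_shift) simp

lemma q_falling_eq_0: "m < n \<Longrightarrow> q_falling m n = 0"
  unfolding q_falling_def by (rule prod_zero) (auto intro!: bexI[of _ m])

text \<open>All symbols $(q;q)_k$ are bounded, and bounded away from 0.\<close>

lemma q_falling_bounded:
  obtains C where "0 < C" "\<And>m n. norm (q_falling m n) \<le> C"
proof -
  obtain C where C: "0 < C" "\<And>n. norm (inverse (qpoch q q n)) \<le> C"
    using inverse_qpoch_bounded[OF qpoch_inf_q_nonzero] by blast
  have eq: "q_falling m n * qpoch q q (m - n) = qpoch q q m" if "n \<le> m" for m n
    using that
  proof (induction n)
    case (Suc n)
    then have "qpoch q q (m - n) = qpoch q q (m - Suc n) * (1 - q ^ (m - n))"
      by (metis Suc_diff_Suc Suc_le_eq power_Suc qpoch_Suc)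
    then show ?case using Suc by (simp add: q_falling_Suc mult_ac)
  qed simp
  let ?B = "exp (norm q / (1 - norm q)) * C"
  have "norm (q_falling m n) \<le> ?B" for m n
  proof (cases "n \<le> m")
    case True
    have "q_falling m n = qpoch q q m * inverse (qpoch q q (m - n))"
      using eq[OF True] by (simp add: field_simps)
    then show ?thesis
      using norm_qpoch_le[of q m] C(2)[of "m - n"] by (simp add: norm_mult mult_mono)
  qed (use C in \<open>simp add: q_falling_eq_0\<close>)
  moreover have "0 < ?B" using C by simp
  ultimately show thesis using that by blast
qed

text \<open>Induction on $n$: with $A = q^{-n}$ and $A' = q^{-n-1}$, the coefficients of the two sums satisfy
  $s_{A'}(k+1) = s_A(k+1) - A' s_A(k)$, which is multiplication by the new factor $1 - A' z$.\<close>

lemma finite_q_binomial: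
  "(\<Sum>k\<le>n. qpoch (q powi (- int n)) q k / qpoch q q k * z ^ k) = (\<Prod>i<n. 1 - z / q ^ Suc i)"
proof (induction n)
  case (Suc n)
  define A where "A = q powi (- int n)"
  define A' where "A' = q powi (- int (Suc n))"
  have A_eq: "A = 1 / q ^ n"
    unfolding A_def by (simp add: power_int_minus field_simps)
  have A'_eq: "A' = 1 / q ^ Suc n"
    unfolding A'_def by (simp add: power_int_minus field_simps del: of_nat_Suc power_Suc)
  have AA': "A' * q = A"
    using q_nonzero by (simp add: A_eq A'_eq)
  have A_zero: "qpoch A q (Suc n) = 0"
    unfolding A_def by (auto simp: qpoch_eq_0_iff power_int_minus q_nonzero intro!: exI[of _ n])
  let ?s = "\<lambda>A k. qpoch A q k / qpoch q q k"
  have step: "?s A' (Suc k) = ?s A (Suc k) - A' * ?s A k" for k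
  proof -
    have nz: "1 - q * q ^ k \<noteq> 0"
      using qpoch_q_nonzero[of "Suc k"] by (simp add: qpoch_Suc)
    have "qpoch A' q (Suc k) = qpoch A q (Suc k) - A' * (1 - q * q ^ k) * qpoch A q k"
      unfolding qpoch_Suc_shift[of A'] AA' qpoch_Suc[of A] unfolding AA'[symmetric]
      by (simp add: algebra_simps)
    then show ?thesis using nz by (simp add: qpoch_Suc[of q] diff_divide_distrib)
  qed
  have "(\<Sum>k\<le>Suc n. ?s A' k * z ^ k) = 1 + (\<Sum>k\<le>n. ?s A' (Suc k) * z ^ Suc k)"
    by (subst sum.atMost_Suc_shift) simp
  also have "\<dots> = (1 + (\<Sum>k\<le>n. ?s A (Suc k) * z ^ Suc k)) - A' * z * (\<Sum>k\<le>n. ?s A k * z ^ k)"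
    by (simp add: step algebra_simps sum_subtractf sum_distrib_left)
  also have "1 + (\<Sum>k\<le>n. ?s A (Suc k) * z ^ Suc k) = (\<Sum>k\<le>Suc n. ?s A k * z ^ k)"
    by (subst sum.atMost_Suc_shift) simp
  also have "\<dots> = (\<Sum>k\<le>n. ?s A k * z ^ k)"
    by (simp add: A_zero)
  finally have "(\<Sum>k\<le>Suc n. ?s A' k * z ^ k) = (1 - z / q ^ Suc n) * (\<Sum>k\<le>n. ?s A k * z ^ k)"
    by (simp add: A'_eq algebra_simps)
  then show ?case
    unfolding A'_def A_def Suc by simp
qed simp

text \<open>The inner sum of the theorem for $f(t) = t^m$: the $q$-binomial theorem at $z = q^{m+1}$.\<close>

lemma inner_sum_power:
  "(\<Sum>k\<le>n. qpoch (q powi (- int n)) q k / qpoch q q k * (q ^ k) ^ m * q ^ k) = q_falling m n"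
proof -
  have "(\<Sum>k\<le>n. qpoch (q powi (- int n)) q k / qpoch q q k * (q ^ k) ^ m * q ^ k) =
        (\<Sum>k\<le>n. qpoch (q powi (- int n)) q k / qpoch q q k * (q ^ Suc m) ^ k)"
    by (intro sum.cong) (simp_all add: power_mult_distrib flip: power_mult, simp add: mult_ac)
  also have "\<dots> = (\<Prod>i<n. 1 - q ^ Suc m / q ^ Suc i)"
    by (rule finite_q_binomial)
  also have "\<dots> = q_falling m n"
  proof (cases "n \<le> m")
    case True
    then show ?thesis unfolding q_falling_def
      using q_nonzero by (intro prod.cong) (auto simp: power_diff)
  next
    case False
    then have "(\<Prod>i<n. 1 - q ^ Suc m / q ^ Suc i) = 0"
      using q_nonzero by (intro prod_zero) (auto intro!: bexI[of _ m])
    then show ?thesis using False by (simp add: q_falling_eq_0)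
  qed
  finally show ?thesis .
qed

definition newton_poly :: "nat \<Rightarrow> complex \<Rightarrow> complex" where
  "newton_poly n t = (\<Prod>i<n. t - q ^ i)"

lemma newton_poly_0 [simp]: "newton_poly 0 t = 1"
  by (simp add: newton_poly_def)

lemma newton_poly_Suc: "newton_poly (Suc n) t = newton_poly n t * (t - q ^ n)"
  by (simp add: newton_poly_def)

lemma newton_poly_rescale: "q ^ n * newton_poly n (t / q) * (t - 1) = newton_poly (Suc n) t"
proof -
  have "q ^ n * newton_poly n (t / q) = (\<Prod>i<n. t - q ^ Suc i)"
    unfolding newton_poly_def using q_nonzero
    by (induction n) (simp_all add: field_simps)
  then show ?thesis
    unfolding newton_poly_def by (subst prod.lessThan_Suc_shift) (simp add: mult_ac)
qed

text \<open>The expansion of a power in the Newton basis for the nodes $1, q, q^2, \<dots>$ has the Gaussian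
  binomial coefficients as its coefficients (Gauss, Cauchy). Up to the factor $(q;q)_n$ these are
  the values of the inner sum found above; this is the link between the two sides. The
  induction step is the Pascal rule.\<close>

lemma power_newton_expansion:
  "t ^ m = (\<Sum>n\<le>m. q_falling m n / qpoch q q n * newton_poly n t)"
proof (induction m)
  case (Suc m)
  let ?g = "\<lambda>m n. q_falling m n / qpoch q q n"
  have step: "?g (Suc m) (Suc n) = ?g m n + q ^ Suc n * ?g m (Suc n)" for n
  proof (cases "n \<le> m")
    case True
    have nz: "1 - q * q ^ n \<noteq> 0"
      using qpoch_q_nonzero[of "Suc n"] by (simp add: qpoch_Suc)
    have "q ^ Suc m = q * q ^ n * q ^ (m - n)"
      using True by (simp flip: power_add)
    then have "q_falling (Suc m) (Suc n) = (1 - q * q ^ n) * q_falling m n + q ^ Suc n * q_falling m (Suc n)"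
      by (simp only: q_falling_Suc_Suc[of m n] q_falling_Suc[of m n]) (simp add: algebra_simps)
    then show ?thesis using nz by (simp add: qpoch_Suc[of q] add_divide_distrib)
  qed (simp add: q_falling_eq_0)
  have "t ^ Suc m = (\<Sum>n\<le>m. ?g m n * newton_poly n t) * t"
    using Suc by simp
  also have "\<dots> = (\<Sum>n\<le>m. ?g m n * newton_poly (Suc n) t) + (\<Sum>n\<le>m. q ^ n * ?g m n * newton_poly n t)"
    unfolding sum_distrib_right sum.distrib[symmetric]
    by (intro sum.cong) (simp_all add: newton_poly_Suc algebra_simps)
  also have "(\<Sum>n\<le>m. q ^ n * ?g m n * newton_poly n t) = (\<Sum>n\<le>Suc m. q ^ n * ?g m n * newton_poly n t)"
    by (simp add: q_falling_eq_0)
  also have "\<dots> = 1 + (\<Sum>n\<le>m. q ^ Suc n * ?g m (Suc n) * newton_poly (Suc n) t)"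
    by (subst sum.atMost_Suc_shift) simp
  also have "(\<Sum>n\<le>m. ?g m n * newton_poly (Suc n) t) + \<dots> = 1 + (\<Sum>n\<le>m. ?g (Suc m) (Suc n) * newton_poly (Suc n) t)"
    unfolding step by (simp add: algebra_simps sum.distrib)
  also have "\<dots> = (\<Sum>n\<le>Suc m. ?g (Suc m) n * newton_poly n t)"
    by (subst sum.atMost_Suc_shift) simp
  finally show ?case .
qed simp

section \<open>Moments of the Andrews--Askey weight\<close>

text \<open>The integrand of the right-hand side without $f$, in terms of $x = c/(ab)$.\<close>

definition weight :: "complex \<Rightarrow> complex \<Rightarrow> complex \<Rightarrow> complex \<Rightarrow> complex" where
  "weight a b x t = qpoch_inf (t * q) q * qpoch_inf (t * q / x) q /
     (qpoch_inf (a * t) q * qpoch_inf (b * t) q)"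

text \<open>The denominator of the weight does not vanish at the nodes $q^n$ and $xq^n$. The condition
  $x \<noteq> 0$ gives a meaning to the argument $tq/x$ in its numerator.\<close>

definition regular_params :: "complex \<Rightarrow> complex \<Rightarrow> complex \<Rightarrow> bool" where
  "regular_params a b x \<longleftrightarrow> x \<noteq> 0 \<and> qpoch_inf a q \<noteq> 0 \<and> qpoch_inf b q \<noteq> 0 \<and>
     qpoch_inf (a * x) q \<noteq> 0 \<and> qpoch_inf (b * x) q \<noteq> 0"

lemma weight_commute: "weight a b x = weight b a x"
  by (auto simp: weight_def)

lemma regular_params_commute: "regular_params a b x \<longleftrightarrow> regular_params b a x"
  by (auto simp: regular_params_def)

lemma regular_params_shift: "regular_params a b x \<Longrightarrow> regular_params (a * q ^ n) b x"
  using qpoch_inf_power_nonzero[of a n] qpoch_inf_power_nonzero[of "a * x" n]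
  by (auto simp: regular_params_def mult_ac)

lemma regular_params_factor_nonzero:
  assumes "regular_params a b x" "v \<in> {1, x}"
  shows "qpoch_inf (a * (v * q ^ n)) q \<noteq> 0" "qpoch_inf (b * (v * q ^ n)) q \<noteq> 0"
  using assms qpoch_inf_power_nonzero[of "a * v" n] qpoch_inf_power_nonzero[of "b * v" n]
  by (auto simp: regular_params_def mult_ac)

text \<open>The bound is uniform in the simultaneous shift of $a$ and $b$, so that it also dominates the limit
  $a, b \<rightarrow> 0$ taken below.\<close>

lemma weight_bounded:
  assumes "regular_params a b x"
  obtains C where "0 < C"
    "\<And>k n v. v \<in> {1, x} \<Longrightarrow> norm (weight (a * q ^ k) (b * q ^ k) x (v * q ^ n)) \<le> C"
proof -
  have *: "\<exists>C>0. \<forall>k n. norm (weight (a * q ^ k) (b * q ^ k) x (v * q ^ n)) \<le> C"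
    if v: "v \<in> {1, x}" for v
  proof -
    have nz: "qpoch_inf (a * v) q \<noteq> 0" "qpoch_inf (b * v) q \<noteq> 0"
      using regular_params_factor_nonzero[OF assms v, of 0] by auto
    obtain A where A: "0 < A" "\<And>n. norm (inverse (qpoch_inf (a * v * q ^ n) q)) \<le> A"
      using inverse_qpoch_inf_power_bounded[OF nz(1)] by blast
    obtain B where B: "0 < B" "\<And>n. norm (inverse (qpoch_inf (b * v * q ^ n) q)) \<le> B"
      using inverse_qpoch_inf_power_bounded[OF nz(2)] by blast
    define E where "E z = exp (norm z / (1 - norm q))" for z :: complex
    have E: "norm (qpoch_inf (z * q ^ n) q) \<le> E z" for z n
    proof -
      have "norm z * norm q ^ n \<le> norm z * 1"
        using q_less_1 by (intro mult_left_mono power_le_one) auto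
      then have "norm (z * q ^ n) / (1 - norm q) \<le> norm z / (1 - norm q)"
        using q_less_1 by (simp add: norm_mult norm_power divide_right_mono)
      then show ?thesis
        using norm_qpoch_inf_le[of "z * q ^ n"] unfolding E_def by (meson exp_le_cancel_iff order_trans)
    qed
    have "norm (weight (a * q ^ k) (b * q ^ k) x (v * q ^ n)) \<le> E (v * q) * E (v * q / x) * (A * B)" for k n
    proof -
      have "weight (a * q ^ k) (b * q ^ k) x (v * q ^ n) =
          qpoch_inf (v * q * q ^ n) q * qpoch_inf (v * q / x * q ^ n) q *
          (inverse (qpoch_inf (a * v * q ^ (k + n)) q) * inverse (qpoch_inf (b * v * q ^ (k + n)) q))"
        by (simp add: weight_def divide_inverse power_add mult_ac)
      also have "norm \<dots> \<le> E (v * q) * E (v * q / x) * (A * B)"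
        unfolding norm_mult
        by (intro mult_mono E A(2) B(2)) (use A B in \<open>auto simp: E_def\<close>)
      finally show ?thesis .
    qed
    moreover have "0 < E (v * q) * E (v * q / x) * (A * B)"
      using A B by (simp add: E_def)
    ultimately show ?thesis by blast
  qed
  obtain C1 where C1: "0 < C1" "\<And>k n. norm (weight (a * q ^ k) (b * q ^ k) x (1 * q ^ n)) \<le> C1"
    using *[of 1] by blast
  obtain C2 where C2: "0 < C2" "\<And>k n. norm (weight (a * q ^ k) (b * q ^ k) x (x * q ^ n)) \<le> C2"
    using *[of x] by blast
  show thesis
    by (rule that[of "max C1 C2"]) (use C1 C2 in \<open>auto simp: le_max_iff_disj\<close>)
qed

lemma norm_jackson_term_le:
  assumes "norm (g (q ^ n)) \<le> C" "norm (g (x * q ^ n)) \<le> C"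
  shows "norm (jackson_term q x 1 g n) \<le> (1 + norm x) * C * norm q ^ n"
proof -
  have "norm (jackson_term q x 1 g n) \<le> norm (q ^ n * g (q ^ n)) + norm (x * q ^ n * g (x * q ^ n))"
    unfolding jackson_term_def mult_1 by (rule norm_triangle_ineq4)
  also have "\<dots> \<le> norm q ^ n * C + norm x * norm q ^ n * C"
    unfolding norm_mult norm_power using assms
    by (intro add_mono mult_mono) auto
  finally show ?thesis by (simp add: algebra_simps)
qed

lemma jackson_integrable_bounded:
  assumes "\<And>n. norm (g (q ^ n)) \<le> C" "\<And>n. norm (g (x * q ^ n)) \<le> C"
  shows "jackson_integrable q x 1 g"
  unfolding jackson_integrable_def
proof (rule summable_comparison_test')
  show "summable (\<lambda>n. (1 + norm x) * C * norm q ^ n)"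
    using q_less_1 by (intro summable_mult summable_geometric) auto
  show "norm (jackson_term q x 1 g n) \<le> (1 + norm x) * C * norm q ^ n" for n
    using norm_jackson_term_le assms by blast
qed

lemma weighted_jackson_integrable:
  assumes "regular_params a b x" "\<And>n. norm (g (q ^ n)) \<le> B" "\<And>n. norm (g (x * q ^ n)) \<le> B"
  shows "jackson_integrable q x 1 (\<lambda>t. weight a b x t * g t)"
proof -
  obtain C where C: "0 < C" "\<And>k n v. v \<in> {1, x} \<Longrightarrow>
      norm (weight (a * q ^ k) (b * q ^ k) x (v * q ^ n)) \<le> C"
    using weight_bounded[OF assms(1)] by blast
  have w: "norm (weight a b x (q ^ n)) \<le> C" "norm (weight a b x (x * q ^ n)) \<le> C" for n
    using C(2)[of 1 0 n] C(2)[of x 0 n] by auto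
  show ?thesis
    by (rule jackson_integrable_bounded[of _ "C * B"])
      (use C(1) assms w in \<open>auto simp: norm_mult intro!: mult_mono\<close>)
qed

lemma bounded_on_nodes:
  assumes "\<And>t. isCont g t"
  obtains B where "\<And>n. norm (g (q ^ n)) \<le> B" "\<And>n. norm (g (x * q ^ n)) \<le> B"
proof -
  have "convergent (\<lambda>n. g (v * q ^ n))" for v
    using isCont_tendsto_compose[OF assms power_q_LIMSEQ[of v]] by (auto intro: convergentI)
  then have "\<exists>B. \<forall>n. norm (g (v * q ^ n)) \<le> B" for v
    using convergent_imp_Bseq Bseq_def by metis
  then obtain B where "\<And>v n. norm (g (v * q ^ n)) \<le> B v" by metis
  from this[of 1] this[of x] show thesis
    using that[of "max (B 1) (B x)"] by (auto simp: le_max_iff_disj)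
qed

lemma jackson_integrable_newton:
  assumes "regular_params a b x"
  shows "jackson_integrable q x 1 (\<lambda>t. weight a b x t * newton_poly n t)"
proof -
  have "isCont (newton_poly n) t" for t
    unfolding newton_poly_def by (intro continuous_intros)
  then obtain B where "\<And>k. norm (newton_poly n (q ^ k)) \<le> B" "\<And>k. norm (newton_poly n (x * q ^ k)) \<le> B"
    using bounded_on_nodes by blast
  then show ?thesis using weighted_jackson_integrable assms by blast
qed

text \<open>This is a $q$-analogue of integration by parts. The integrand of the difference of the two
  sides, multiplied by $t$, is a constant times a $q$-difference $V(t) - V(tq)$, so its Jackson integral telescopes.\<close>

lemma newton_moment_step:
  assumes reg: "regular_params a b x"
  defines "M \<equiv> \<lambda>n. jackson_integral q x 1 (\<lambda>t. weight a b x t * newton_poly n t)"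
  shows "(1 - a * b * x * q ^ n) * M (Suc n) = x * (1 - a * q ^ n) * (1 - b * q ^ n) * M n"
proof -
  have x: "x \<noteq> 0" using reg by (simp add: regular_params_def)
  \<comment> \<open>The factors vanishing at $t = 1$ and $t = x$ kill the boundary terms at the two end points.
    The boundary terms at 0 agree for the two halves of the integral and cancel.\<close>
  define V where "V t = qpoch_inf t q * qpoch_inf (t / x) q /
      (qpoch_inf (a * t) q * qpoch_inf (b * t) q) * newton_poly n (t / q)" for t
  let ?T = "\<lambda>n. jackson_term q x 1 (\<lambda>t. weight a b x t * newton_poly n t)"
  let ?c1 = "1 - a * b * x * q ^ n" and ?c2 = "x * (1 - a * q ^ n) * (1 - b * q ^ n)"
  have diff: "x * q ^ n * (V t - V (t * q)) = t * weight a b x t * (?c1 * newton_poly (Suc n) t - ?c2 * newton_poly n t)"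
    if "qpoch_inf (a * t) q \<noteq> 0" "qpoch_inf (b * t) q \<noteq> 0" for t
  proof -
    have a: "qpoch_inf (a * t) q = (1 - a * t) * qpoch_inf (a * (t * q)) q"
      and b: "qpoch_inf (b * t) q = (1 - b * t) * qpoch_inf (b * (t * q)) q"
      using qpoch_inf_shift[of "a * t"] qpoch_inf_shift[of "b * t"] by (simp_all add: mult_ac)
    have n1: "1 - a * t \<noteq> 0" "1 - b * t \<noteq> 0"
      using that unfolding a b by auto
    have V1: "V (t * q) = weight a b x t * ((1 - a * t) * (1 - b * t)) * newton_poly n t"
      using n1 q_nonzero unfolding V_def weight_def a b by simp
    have V_eq: "q ^ n * (t - 1) * V t = weight a b x t * (1 - t) * (1 - t / x) * newton_poly (Suc n) t"
      unfolding newton_poly_rescale[symmetric] unfolding V_def weight_def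
        qpoch_inf_shift[of t] qpoch_inf_shift[of "t / x"] by (simp add: mult_ac)
    have x_diff: "x * (1 - t / x) = x - t"
      using x by (simp add: field_simps)
    have "(t - 1) * (x * q ^ n * V t) = x * (q ^ n * (t - 1) * V t)"
      by (simp add: mult_ac)
    also have "\<dots> = weight a b x t * (1 - t) * (x * (1 - t / x)) * newton_poly (Suc n) t"
      unfolding V_eq by (simp only: mult_ac)
    also have "\<dots> = (t - 1) * - (weight a b x t * (x - t) * newton_poly (Suc n) t)"
      unfolding x_diff by (simp add: algebra_simps)
    finally have V2: "x * q ^ n * V t = - (weight a b x t * (x - t) * newton_poly (Suc n) t)" if "t \<noteq> 1"
      using that by (simp only: mult_cancel_left) simp
    \<comment> \<open>The factor $t - 1$ was cancelled above; at the node $t = 1$ both sides vanish.\<close>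
    have V3: "x * q ^ n * V t = - (weight a b x t * (x - t) * newton_poly (Suc n) t)"
    proof (cases "t = 1")
      case True
      have "newton_poly (Suc n) 1 = 0"
        unfolding newton_poly_rescale[symmetric] by simp
      then show ?thesis using True by (simp add: V_def)
    qed (rule V2)
    show ?thesis
      unfolding right_diff_distrib V3 V1 newton_poly_Suc by (simp add: algebra_simps)
  qed
  have telescoped: "?c1 * ?T (Suc n) j - ?c2 * ?T n j =
      x * q ^ n * ((V (q ^ j) - V (q ^ Suc j)) - (V (x * q ^ j) - V (x * q ^ Suc j)))" for j
  proof -
    have d1: "x * q ^ n * (V (q ^ j) - V (q ^ j * q)) =
        q ^ j * weight a b x (q ^ j) * (?c1 * newton_poly (Suc n) (q ^ j) - ?c2 * newton_poly n (q ^ j))"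
      using regular_params_factor_nonzero[OF reg, of 1 j] by (intro diff) simp_all
    have d2: "x * q ^ n * (V (x * q ^ j) - V (x * q ^ j * q)) = x * q ^ j * weight a b x (x * q ^ j) *
        (?c1 * newton_poly (Suc n) (x * q ^ j) - ?c2 * newton_poly n (x * q ^ j))"
      using regular_params_factor_nonzero[OF reg, of x j] by (intro diff) simp_all
    have "?c1 * ?T (Suc n) j - ?c2 * ?T n j =
        q ^ j * weight a b x (q ^ j) * (?c1 * newton_poly (Suc n) (q ^ j) - ?c2 * newton_poly n (q ^ j)) -
        x * q ^ j * weight a b x (x * q ^ j) *
          (?c1 * newton_poly (Suc n) (x * q ^ j) - ?c2 * newton_poly n (x * q ^ j))"
      by (simp add: jackson_term_def algebra_simps)
    also have "\<dots> = x * q ^ n * (V (q ^ j) - V (q ^ j * q)) - x * q ^ n * (V (x * q ^ j) - V (x * q ^ j * q))"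
      unfolding d1 d2 ..
    finally show ?thesis by (simp add: right_diff_distrib mult_ac)
  qed
  have "isCont V 0"
    unfolding V_def newton_poly_def using x q_nonzero
    by (intro continuous_intros isCont_o2[OF _ qpoch_inf_isCont]) auto
  then have V0: "(\<lambda>j. V (v * q ^ j)) \<longlonglongrightarrow> V 0" for v
    using isCont_tendsto_compose power_q_LIMSEQ by blast
  have ends: "V 1 = 0" "V x = 0"
    using x by (simp_all add: V_def)
  have "(\<lambda>j. x * q ^ n * ((V (q ^ j) - V (q ^ Suc j)) - (V (x * q ^ j) - V (x * q ^ Suc j)))) sums
      (x * q ^ n * ((V (1 * q ^ 0) - V 0) - (V (x * q ^ 0) - V 0)))"
    using sums_mult[OF sums_diff[OF telescope_sums'[OF V0[of 1]] telescope_sums'[OF V0[of x]]]]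
    by simp
  then have "(\<lambda>j. ?c1 * ?T (Suc n) j - ?c2 * ?T n j) sums 0"
    unfolding telescoped by (simp add: ends)
  moreover have "(\<lambda>j. ?c1 * ?T (Suc n) j - ?c2 * ?T n j) sums (?c1 * M (Suc n) - ?c2 * M n)"
    using jackson_integrable_newton[OF reg] unfolding M_def jackson_integral_def jackson_integrable_def
    by (intro sums_diff sums_mult summable_sums)
  ultimately show ?thesis
    using sums_unique2 by fastforce
qed

abbreviation total_mass :: "complex \<Rightarrow> complex \<Rightarrow> complex \<Rightarrow> complex" where
  "total_mass a b x \<equiv> jackson_integral q x 1 (weight a b x)"

text \<open>Replacing $a$ by $aq$ multiplies the weight by $1 - at = (1 - a) - a(t - 1)$, which is a combination
  of the Newton polynomials of degrees 0 and 1. Their moments are related by the recurrence just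
  proved.\<close>

lemma total_mass_shift:
  assumes reg: "regular_params a b x"
  shows "(1 - a * b * x) * total_mass (a * q) b x = (1 - a) * (1 - a * x) * total_mass a b x"
proof -
  let ?M = "\<lambda>n. jackson_integral q x 1 (\<lambda>t. weight a b x t * newton_poly n t)"
  let ?T = "\<lambda>n. jackson_term q x 1 (\<lambda>t. weight a b x t * newton_poly n t)"
  have w: "weight (a * q) b x t = weight a b x t * (1 - a * t)" if "qpoch_inf (a * t) q \<noteq> 0" for t
  proof -
    have a: "qpoch_inf (a * t) q = (1 - a * t) * qpoch_inf (a * q * t) q"
      using qpoch_inf_shift[of "a * t"] by (simp add: mult_ac)
    have "1 - a * t \<noteq> 0" using that unfolding a by auto
    then show ?thesis unfolding weight_def a by simp
  qed
  have "jackson_term q x 1 (weight (a * q) b x) = (\<lambda>j. (1 - a) * ?T 0 j - a * ?T 1 j)"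
  proof
    fix j
    have w1: "weight (a * q) b x (q ^ j) = weight a b x (q ^ j) * (1 - a * q ^ j)"
      using regular_params_factor_nonzero[OF reg, of 1 j] by (intro w) simp
    have w2: "weight (a * q) b x (x * q ^ j) = weight a b x (x * q ^ j) * (1 - a * (x * q ^ j))"
      using regular_params_factor_nonzero[OF reg, of x j] by (intro w) simp
    show "jackson_term q x 1 (weight (a * q) b x) j = (1 - a) * ?T 0 j - a * ?T 1 j"
      unfolding jackson_term_def mult_1 w1 w2 newton_poly_def by (simp add: algebra_simps)
  qed
  moreover have "(\<lambda>j. (1 - a) * ?T 0 j - a * ?T 1 j) sums ((1 - a) * ?M 0 - a * ?M 1)"
    using jackson_integrable_newton[OF reg] unfolding jackson_integral_def jackson_integrable_def
    by (intro sums_diff sums_mult summable_sums)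
  ultimately have mass: "total_mass (a * q) b x = (1 - a) * ?M 0 - a * ?M 1"
    unfolding jackson_integral_def by (simp add: sums_iff)
  have "(1 - a * b * x) * total_mass (a * q) b x =
      (1 - a) * (1 - a * b * x) * ?M 0 - a * ((1 - a * b * x) * ?M 1)"
    unfolding mass by (simp add: algebra_simps)
  also have "(1 - a * b * x) * ?M 1 = x * (1 - a) * (1 - b) * ?M 0"
    using newton_moment_step[OF reg, of 0] by simp
  finally show ?thesis by (simp add: algebra_simps)
qed

lemma total_mass_shift_power:
  assumes reg: "regular_params a b x"
  shows "qpoch (a * b * x) q n * total_mass (a * q ^ n) b x =
    qpoch a q n * qpoch (a * x) q n * total_mass a b x"
proof (induction n)
  case (Suc n)
  have "qpoch (a * b * x) q (Suc n) * total_mass (a * q ^ Suc n) b x =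
      qpoch (a * b * x) q n * ((1 - a * q ^ n * b * x) * total_mass (a * q ^ n * q) b x)"
    by (simp add: qpoch_Suc mult_ac)
  also have "\<dots> = (1 - a * q ^ n) * (1 - a * q ^ n * x) *
      (qpoch (a * b * x) q n * total_mass (a * q ^ n) b x)"
    unfolding total_mass_shift[OF regular_params_shift[OF reg]] by (simp add: mult_ac)
  also have "\<dots> = (1 - a * q ^ n) * (1 - a * q ^ n * x) *
      (qpoch a q n * qpoch (a * x) q n * total_mass a b x)"
    unfolding Suc ..
  finally show ?case by (simp add: qpoch_Suc mult_ac)
qed simp

lemma total_mass_commute: "total_mass a b x = total_mass b a x"
  by (simp add: weight_commute)

lemma total_mass_LIMSEQ:
  assumes reg: "regular_params a b x"
  shows "(\<lambda>k. total_mass (a * q ^ k) (b * q ^ k) x) \<longlonglongrightarrow> total_mass 0 0 x"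
proof -
  obtain C where C: "0 < C" "\<And>k n v. v \<in> {1, x} \<Longrightarrow>
      norm (weight (a * q ^ k) (b * q ^ k) x (v * q ^ n)) \<le> C"
    using weight_bounded[OF reg] by blast
  have w: "(\<lambda>k. weight (a * q ^ k) (b * q ^ k) x t) \<longlonglongrightarrow> weight 0 0 x t" for t
  proof -
    have "(\<lambda>k. weight (a * q ^ k) (b * q ^ k) x t) \<longlonglongrightarrow>
        qpoch_inf (t * q) q * qpoch_inf (t * q / x) q / (1 * 1)"
      using qpoch_inf_power_LIMSEQ[of "a * t"] qpoch_inf_power_LIMSEQ[of "b * t"]
      unfolding weight_def by (intro tendsto_intros) (auto simp: mult_ac)
    then show ?thesis by (simp add: weight_def)
  qed
  let ?T = "\<lambda>n k. jackson_term q x 1 (weight (a * q ^ k) (b * q ^ k) x) n"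
  have "(\<lambda>k. \<Sum>n. ?T n k) \<longlonglongrightarrow> (\<Sum>n. jackson_term q x 1 (weight 0 0 x) n)"
  proof (rule tannerys_theorem[THEN conjunct2, THEN conjunct2])
    show "(\<lambda>k. ?T n k) \<longlonglongrightarrow> jackson_term q x 1 (weight 0 0 x) n" for n
      unfolding jackson_term_def by (intro tendsto_intros w)
    have "norm (?T n k) \<le> (1 + norm x) * C * norm q ^ n" for n k
      using C(2)[of 1 k n] C(2)[of x k n] by (intro norm_jackson_term_le) auto
    then show "\<forall>\<^sub>F (n, k) in sequentially \<times>\<^sub>F sequentially. norm (?T n k) \<le> (1 + norm x) * C * norm q ^ n"
      by (simp add: case_prod_unfold)
    show "summable (\<lambda>n. (1 + norm x) * C * norm q ^ n)"
      using q_less_1 by (intro summable_mult summable_geometric) auto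
  qed simp
  then show ?thesis unfolding jackson_integral_def .
qed

text \<open>Shift $a$ and $b$ by $q^n$ and let $n$ tend to infinity. Hence the product on the left depends on
  $a$ and $b$ only through $(abx;q)_\<infinity>$.\<close>

lemma total_mass_reduction:
  assumes reg: "regular_params a b x"
  shows "qpoch_inf a q * qpoch_inf (a * x) q * qpoch_inf b q * qpoch_inf (b * x) q * total_mass a b x =
    qpoch_inf (a * b * x) q * total_mass 0 0 x"
proof (rule LIMSEQ_unique)
  let ?c = "a * b * x"
  have eq: "qpoch ?c q (n + n) * total_mass (a * q ^ n) (b * q ^ n) x =
      qpoch a q n * qpoch (a * x) q n * (qpoch b q n * qpoch (b * x) q n * total_mass a b x)" for n
  proof -
    have reg': "regular_params b (a * q ^ n) x"
      using regular_params_shift[OF reg] regular_params_commute by blast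
    have "qpoch ?c q (n + n) * total_mass (a * q ^ n) (b * q ^ n) x =
        qpoch ?c q n * (qpoch (b * (a * q ^ n) * x) q n * total_mass (b * q ^ n) (a * q ^ n) x)"
      by (subst total_mass_commute) (simp add: qpoch_add mult_ac)
    also have "\<dots> = qpoch b q n * qpoch (b * x) q n * (qpoch ?c q n * total_mass (a * q ^ n) b x)"
      unfolding total_mass_shift_power[OF reg'] total_mass_commute[of x b "a * q ^ n"] by (simp add: mult_ac)
    finally show ?thesis unfolding total_mass_shift_power[OF reg] by (simp add: mult_ac)
  qed
  show "(\<lambda>n. qpoch ?c q (n + n) * total_mass (a * q ^ n) (b * q ^ n) x) \<longlonglongrightarrow>
      qpoch_inf ?c q * total_mass 0 0 x"
    using LIMSEQ_subseq_LIMSEQ[OF qpoch_LIMSEQ[of ?c], of "\<lambda>n. n + n"]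
    by (intro tendsto_mult total_mass_LIMSEQ[OF reg]) (auto simp: strict_mono_def o_def)
  show "(\<lambda>n. qpoch ?c q (n + n) * total_mass (a * q ^ n) (b * q ^ n) x) \<longlonglongrightarrow>
      qpoch_inf a q * qpoch_inf (a * x) q * qpoch_inf b q * qpoch_inf (b * x) q * total_mass a b x"
    unfolding eq unfolding mult.assoc by (intro tendsto_intros qpoch_LIMSEQ)
qed

text \<open>By the reduction it suffices to know the integral for one pair of parameters. For $a = q$ and
  $b = q/x$ the weight is identically 1 at the nodes, and the integral is a geometric series.\<close>

lemma total_mass_zero_params:
  assumes x: "x \<noteq> 0" "qpoch_inf x q \<noteq> 0" "qpoch_inf (q / x) q \<noteq> 0"
  shows "total_mass 0 0 x = qpoch_inf q q * qpoch_inf x q * qpoch_inf (q / x) q"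
proof -
  have xq: "qpoch_inf (q * x) q \<noteq> 0"
    using qpoch_inf_power_nonzero[OF x(2), of 1] by (simp add: mult_ac)
  have reg: "regular_params q (q / x) x"
    using x xq by (simp add: regular_params_def)
  have w: "weight q (q / x) x (v * q ^ j) = 1" if "v \<in> {1, x}" for v j
    using regular_params_factor_nonzero[OF reg that, of j] by (simp add: weight_def mult_ac)
  have "jackson_term q x 1 (weight q (q / x) x) = (\<lambda>j. (1 - x) * q ^ j)"
  proof
    show "jackson_term q x 1 (weight q (q / x) x) j = (1 - x) * q ^ j" for j
      using w[of 1 j] w[of x j] by (simp add: jackson_term_def algebra_simps)
  qed
  moreover have "(\<lambda>j. (1 - x) * q ^ j) sums ((1 - x) * (1 / (1 - q)))"
    using q_less_1 by (intro sums_mult geometric_sums)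
  ultimately have mass: "total_mass q (q / x) x = (1 - x) / (1 - q)"
    unfolding jackson_integral_def by (simp add: sums_iff)
  have q1: "1 - q \<noteq> 0" using q_less_1 by auto
  have qq: "qpoch_inf q q = (1 - q) * qpoch_inf (q * q) q"
    by (rule qpoch_inf_shift)
  have qq0: "qpoch_inf (q * q) q \<noteq> 0"
    using qpoch_inf_q_nonzero unfolding qq by auto
  have "qpoch_inf (q * q) q * total_mass 0 0 x =
      qpoch_inf q q * qpoch_inf (x * q) q * qpoch_inf (q / x) q * (qpoch_inf q q * ((1 - x) / (1 - q)))"
    using total_mass_reduction[OF reg] x(1) unfolding mass by (simp add: mult_ac)
  also have "qpoch_inf q q * ((1 - x) / (1 - q)) = qpoch_inf (q * q) q * (1 - x)"
    using q1 by (simp add: qq)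
  finally have "qpoch_inf (q * q) q * total_mass 0 0 x =
      qpoch_inf (q * q) q * (qpoch_inf q q * ((1 - x) * qpoch_inf (x * q) q) * qpoch_inf (q / x) q)"
    by (simp add: mult_ac)
  then show ?thesis
    using qq0 unfolding qpoch_inf_shift[of x] by simp
qed

lemma andrews_askey:
  assumes "regular_params a b x" "qpoch_inf x q \<noteq> 0" "qpoch_inf (q / x) q \<noteq> 0"
  shows "qpoch_inf a q * qpoch_inf (a * x) q * qpoch_inf b q * qpoch_inf (b * x) q * total_mass a b x =
    qpoch_inf (a * b * x) q * qpoch_inf q q * qpoch_inf x q * qpoch_inf (q / x) q"
  using total_mass_reduction[OF assms(1)] total_mass_zero_params[OF _ assms(2,3)] assms(1)
  by (simp add: regular_params_def mult_ac)

lemma newton_moment: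
  assumes reg: "regular_params a b x" and c: "qpoch_inf (a * b * x) q \<noteq> 0"
  shows "jackson_integral q x 1 (\<lambda>t. weight a b x t * newton_poly n t) =
    total_mass a b x * (qpoch a q n * qpoch b q n / qpoch (a * b * x) q n * x ^ n)"
proof (induction n)
  case (Suc n)
  have "qpoch (a * b * x) q (Suc n) \<noteq> 0" using c by (rule qpoch_nonzero)
  then have "1 - a * b * x * q ^ n \<noteq> 0" by (simp add: qpoch_Suc)
  moreover have "qpoch (a * b * x) q n \<noteq> 0" using c by (rule qpoch_nonzero)
  ultimately show ?case
    using newton_moment_step[OF reg, of n] unfolding Suc
    by (simp add: qpoch_Suc field_simps)
qed simp

text \<open>The sum over $n$ is the left-hand side of the theorem for $f(t) = t^m$, so this is the identity for
  monomials, up to the evaluation of the total mass.\<close>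

lemma power_moment:
  assumes reg: "regular_params a b x" and c: "qpoch_inf (a * b * x) q \<noteq> 0"
  shows "jackson_term q x 1 (\<lambda>t. weight a b x t * t ^ m) sums
    (total_mass a b x * (\<Sum>n\<le>m. qpoch a q n * qpoch b q n / (qpoch (a * b * x) q n * qpoch q q n) *
       x ^ n * q_falling m n))"
proof -
  let ?T = "\<lambda>n. jackson_term q x 1 (\<lambda>t. weight a b x t * newton_poly n t)"
  let ?g = "\<lambda>n. q_falling m n / qpoch q q n"
  have "jackson_term q x 1 (\<lambda>t. weight a b x t * t ^ m) = (\<lambda>j. \<Sum>n\<le>m. ?g n * ?T n j)"
    unfolding jackson_term_def power_newton_expansion[of _ m]
    by (simp add: sum_distrib_left sum_subtractf algebra_simps)
  moreover have "(\<lambda>j. \<Sum>n\<le>m. ?g n * ?T n j) sums (\<Sum>n\<le>m. ?g n *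
      jackson_integral q x 1 (\<lambda>t. weight a b x t * newton_poly n t))"
    using jackson_integrable_newton[OF reg] unfolding jackson_integral_def jackson_integrable_def
    by (intro sums_sum sums_mult summable_sums)
  ultimately show ?thesis
    unfolding newton_moment[OF reg c] by (simp add: sum_distrib_left mult_ac cong: sum.cong)
qed

end

section \<open>The identity for holomorphic functions\<close>

lemma sums_swap_product_bound:
  fixes u :: "nat \<Rightarrow> nat \<Rightarrow> 'a::banach" and \<alpha> \<beta> :: "nat \<Rightarrow> real"
  assumes bound: "\<And>n m. norm (u n m) \<le> \<alpha> n * \<beta> m"
    and nonneg: "\<And>n. 0 \<le> \<alpha> n" "\<And>m. 0 \<le> \<beta> m"
    and summable: "summable \<alpha>" "summable \<beta>"
  obtains S where "(\<lambda>n. \<Sum>m. u n m) sums S" "(\<lambda>m. \<Sum>n. u n m) sums S"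
proof -
  have on: "\<alpha> summable_on UNIV" "\<beta> summable_on UNIV"
    using summable nonneg by (auto intro: norm_summable_imp_summable_on)
  have "(\<lambda>p. norm (\<alpha> (fst p) * \<beta> (snd p))) summable_on UNIV \<times> UNIV"
    unfolding Infinite_Sum.abs_summable_on_Sigma_iff using on nonneg
    by (auto simp: norm_mult abs_mult infsum_cmult_right' intro!: summable_on_cmult_right summable_on_cmult_left)
  then have "(\<lambda>p. norm (u (fst p) (snd p))) summable_on UNIV \<times> UNIV"
    by (rule Infinite_Sum.abs_summable_on_comparison_test) (use bound nonneg in \<open>simp add: abs_mult\<close>)
  then have "(\<lambda>p. u (fst p) (snd p)) summable_on UNIV \<times> UNIV"
    by (rule abs_summable_summable)
  then obtain S where S: "((\<lambda>p. u (fst p) (snd p)) has_sum S) (UNIV \<times> UNIV)"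
    by (auto simp: summable_on_def)
  have rows: "((\<lambda>m. u n m) has_sum (\<Sum>m. u n m)) UNIV" for n
  proof -
    have "summable (\<lambda>m. norm (u n m))"
      by (rule summable_comparison_test'[of "\<lambda>m. \<alpha> n * \<beta> m" 0])
        (use bound summable in \<open>auto intro: summable_mult\<close>)
    from norm_summable_imp_has_sum[OF this summable_sums[OF summable_norm_cancel[OF this]]]
    show ?thesis .
  qed
  have cols: "((\<lambda>n. u n m) has_sum (\<Sum>n. u n m)) UNIV" for m
  proof -
    have "summable (\<lambda>n. norm (u n m))"
      by (rule summable_comparison_test'[of "\<lambda>n. \<alpha> n * \<beta> m" 0])
        (use bound summable in \<open>auto intro: summable_mult2\<close>)
    from norm_summable_imp_has_sum[OF this summable_sums[OF summable_norm_cancel[OF this]]]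
    show ?thesis .
  qed
  have row_sum: "((\<lambda>n. \<Sum>m. u n m) has_sum S) UNIV"
    by (rule has_sum_SigmaD[OF S]) (simp add: rows)
  have "((\<lambda>p. u (snd p) (fst p)) has_sum S) (UNIV \<times> UNIV)"
    using iffD1[OF has_sum_swap S] by (simp add: case_prod_unfold)
  then have col_sum: "((\<lambda>m. \<Sum>n. u n m) has_sum S) UNIV"
    by (rule has_sum_SigmaD) (simp add: cols)
  show thesis
    by (rule that[OF has_sum_imp_sums[OF row_sum] has_sum_imp_sums[OF col_sum]])
qed

locale q_taylor = q_base +
  fixes R :: real and f :: "complex \<Rightarrow> complex"
  assumes R_gt_1: "R > 1" and f_holomorphic: "f holomorphic_on ball 0 R"
begin

definition taylor :: "nat \<Rightarrow> complex" where
  "taylor m = (deriv ^^ m) f 0 / fact m"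

lemma taylor_sums: "norm z < R \<Longrightarrow> (\<lambda>m. taylor m * z ^ m) sums f z"
  using holomorphic_power_series[OF f_holomorphic, of z] by (simp add: taylor_def)

lemma summable_norm_taylor:
  assumes "0 \<le> \<rho>" "\<rho> < R"
  shows "summable (\<lambda>m. norm (taylor m) * \<rho> ^ m)"
proof -
  obtain r where r: "\<rho> < r" "r < R" using dense assms by blast
  then have "summable (\<lambda>m. taylor m * of_real r ^ m)"
    using taylor_sums[of "of_real r"] assms by (auto simp: sums_iff)
  then have "summable (\<lambda>m. norm (taylor m * of_real \<rho> ^ m))"
    by (rule powser_insidea) (use r assms in auto)
  then show ?thesis using assms by (simp add: norm_mult norm_power)
qed

definition inner_sum :: "nat \<Rightarrow> complex" where
  "inner_sum n = (\<Sum>k\<le>n. qpoch (q powi (- int n)) q k / qpoch q q k * f (q ^ k) * q ^ k)"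

lemma inner_sum_sums: "(\<lambda>m. taylor m * q_falling m n) sums inner_sum n"
proof -
  let ?c = "\<lambda>k. qpoch (q powi (- int n)) q k / qpoch q q k"
  have "norm (q ^ k) < R" for k
    using q_less_1 R_gt_1 by (auto simp: norm_power intro!: order.strict_trans1[of _ 1] power_le_one)
  then have "(\<lambda>m. \<Sum>k\<le>n. ?c k * (taylor m * (q ^ k) ^ m) * q ^ k) sums inner_sum n"
    unfolding inner_sum_def by (intro sums_sum sums_mult sums_mult2 taylor_sums)
  moreover have "(\<Sum>k\<le>n. ?c k * (taylor m * (q ^ k) ^ m) * q ^ k) = taylor m * q_falling m n" for m
    unfolding inner_sum_power[symmetric] sum_distrib_left by (intro sum.cong) (simp_all add: mult_ac)
  ultimately show ?thesis by simp
qed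

text \<open>Only $n \<le> m$ contributes, and there $1 \<le> \<rho>^{m-n}$. This trades the decay of the Taylor coefficients
  for geometric decay in $n$, and it separates the variables, as needed for exchanging summations.\<close>

lemma taylor_q_falling_bound:
  assumes "1 \<le> \<rho>"
  obtains K where "0 < K"
    "\<And>m n. norm (taylor m * q_falling m n) \<le> K * (1 / \<rho>) ^ n * (norm (taylor m) * \<rho> ^ m)"
proof -
  obtain K where K: "0 < K" "\<And>m n. norm (q_falling m n) \<le> K"
    using q_falling_bounded by blast
  have "norm (taylor m * q_falling m n) \<le> K * (1 / \<rho>) ^ n * (norm (taylor m) * \<rho> ^ m)" for m n
  proof (cases "n \<le> m")
    case True
    have "1 \<le> \<rho> ^ (m - n)" using assms by (rule one_le_power)
    also have "\<rho> ^ (m - n) = (1 / \<rho>) ^ n * \<rho> ^ m"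
      using True assms by (simp add: power_diff power_one_over field_simps)
    finally have "K * norm (taylor m) * 1 \<le> K * norm (taylor m) * ((1 / \<rho>) ^ n * \<rho> ^ m)"
      using K(1) by (intro mult_left_mono) auto
    moreover have "norm (taylor m * q_falling m n) \<le> norm (taylor m) * K"
      using K(2) by (simp add: norm_mult mult_left_mono)
    ultimately show ?thesis by (simp add: mult_ac)
  qed (use K assms in \<open>simp add: q_falling_eq_0\<close>)
  with K(1) show thesis using that by blast
qed

text \<open>The geometric decay of the inner sums, at every rate below $R$, is the reason why the
  left-hand side converges for $|c/ab| < R$ and not only for $|c/ab| < 1$.\<close>

lemma inner_sum_bound:
  assumes "1 \<le> \<rho>" "\<rho> < R"
  obtains C where "0 \<le> C" "\<And>n. norm (inner_sum n) \<le> C * (1 / \<rho>) ^ n"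
proof -
  obtain K where K: "0 < K"
    "\<And>m n. norm (taylor m * q_falling m n) \<le> K * (1 / \<rho>) ^ n * (norm (taylor m) * \<rho> ^ m)"
    using taylor_q_falling_bound[OF assms(1)] by blast
  have s: "summable (\<lambda>m. norm (taylor m) * \<rho> ^ m)"
    using assms by (intro summable_norm_taylor) auto
  let ?S = "\<Sum>m. norm (taylor m) * \<rho> ^ m"
  have "norm (inner_sum n) \<le> K * ?S * (1 / \<rho>) ^ n" for n
  proof -
    have "norm (inner_sum n) = norm (\<Sum>m. taylor m * q_falling m n)"
      using inner_sum_sums[of n] by (simp add: sums_iff)
    also have "\<dots> \<le> (\<Sum>m. K * (1 / \<rho>) ^ n * (norm (taylor m) * \<rho> ^ m))"
      by (intro norm_suminf_le summable_mult s K)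
    also have "\<dots> = K * (1 / \<rho>) ^ n * ?S"
      using s by (rule suminf_mult)
    finally show ?thesis by (simp add: mult_ac)
  qed
  moreover have "0 \<le> K * ?S"
    using K assms s by (intro mult_nonneg_nonneg suminf_nonneg) auto
  ultimately show thesis using that by blast
qed

text \<open>Both sides are double series over Taylor coefficients of $f$, each dominated by a product of two
  convergent series. Summing over the Taylor index last reduces the identity to monomials.\<close>

lemma weighted_jackson_integral_expansion:
  assumes reg: "regular_params a b x" and c: "qpoch_inf (a * b * x) q \<noteq> 0" and x: "norm x < R"
  obtains S where
    "(\<lambda>n. qpoch a q n * qpoch b q n / (qpoch (a * b * x) q n * qpoch q q n) * x ^ n * inner_sum n) sums S"
    "jackson_term q x 1 (\<lambda>t. weight a b x t * f t) sums (total_mass a b x * S)"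
proof -
  define A where "A n = qpoch a q n * qpoch b q n / (qpoch (a * b * x) q n * qpoch q q n)" for n
  define u where "u n m = A n * x ^ n * (taylor m * q_falling m n)" for n m
  define v where "v m = jackson_term q x 1 (\<lambda>t. weight a b x t * t ^ m)" for m
  \<comment> \<open>All nodes lie in the disc of radius $\<rho>$, where the Taylor series converges absolutely.\<close>
  obtain \<rho> where \<rho>: "max 1 (norm x) < \<rho>" "\<rho> < R"
    using dense x R_gt_1 by (metis max_less_iff_conj)
  obtain K where K: "0 < K"
    "\<And>m n. norm (taylor m * q_falling m n) \<le> K * (1 / \<rho>) ^ n * (norm (taylor m) * \<rho> ^ m)"
    using taylor_q_falling_bound[of \<rho>] \<rho> by auto
  have "A \<longlonglongrightarrow> qpoch_inf a q * qpoch_inf b q / (qpoch_inf (a * b * x) q * qpoch_inf q q)"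
    using c unfolding A_def by (intro tendsto_intros qpoch_LIMSEQ) simp_all
  then have "convergent A"
    by (rule convergentI)
  then obtain B where B: "0 < B" "\<And>n. norm (A n) \<le> B"
    using convergent_imp_Bseq Bseq_def by metis
  have summ: "summable (\<lambda>m. norm (taylor m) * \<rho> ^ m)"
    using \<rho> by (intro summable_norm_taylor) auto
  have "norm (u n m) \<le> B * K * (norm x / \<rho>) ^ n * (norm (taylor m) * \<rho> ^ m)" for n m
  proof -
    have "norm (u n m) = norm (A n) * (norm x ^ n * norm (taylor m * q_falling m n))"
      by (simp add: u_def norm_mult norm_power mult_ac)
    also have "\<dots> \<le> B * (norm x ^ n * (K * (1 / \<rho>) ^ n * (norm (taylor m) * \<rho> ^ m)))"
      using B by (intro mult_mono K order_refl) auto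
    finally show ?thesis by (simp add: power_divide mult_ac)
  qed
  then obtain S where S: "(\<lambda>n. \<Sum>m. u n m) sums S" "(\<lambda>m. \<Sum>n. u n m) sums S"
    by (rule sums_swap_product_bound[of u])
      (use \<rho> B K summ in \<open>auto intro!: summable_mult summable_geometric\<close>)
  have row: "(\<Sum>m. u n m) = A n * x ^ n * inner_sum n" for n
    unfolding u_def using sums_mult[OF inner_sum_sums[of n], of "A n * x ^ n"] by (simp add: sums_iff)
  have col: "(\<Sum>n. u n m) = taylor m * (\<Sum>n\<le>m. A n * x ^ n * q_falling m n)" for m
  proof -
    have "(\<Sum>n. u n m) = (\<Sum>n\<le>m. u n m)"
      by (rule suminf_finite) (auto simp: u_def q_falling_eq_0)
    then show ?thesis by (simp add: u_def sum_distrib_left mult_ac)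
  qed
  have v_sums: "v m sums (total_mass a b x * (\<Sum>n\<le>m. A n * x ^ n * q_falling m n))" for m
    unfolding v_def A_def by (rule power_moment[OF reg c])
  obtain C where C: "0 < C" "\<And>k n v. v \<in> {1, x} \<Longrightarrow>
      norm (weight (a * q ^ k) (b * q ^ k) x (v * q ^ n)) \<le> C"
    using weight_bounded[OF reg] by blast
  have node: "norm (t * q ^ j) \<le> \<rho>" if "t \<in> {1, x}" for t j
  proof -
    have "norm t * norm q ^ j \<le> \<rho> * 1"
      using that \<rho> q_less_1 by (intro mult_mono power_le_one) auto
    then show ?thesis by (simp add: norm_mult norm_power)
  qed
  have "norm (taylor m * v m j) \<le> (1 + norm x) * C * norm q ^ j * (norm (taylor m) * \<rho> ^ m)" for j m
  proof -
    have w: "norm (weight a b x (t * q ^ j) * (t * q ^ j) ^ m) \<le> C * \<rho> ^ m" if "t \<in> {1, x}" for t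
      unfolding norm_mult[of "weight _ _ _ _"] norm_power using that C(1) C(2)[OF that, of 0 j] node[OF that, of j]
      by (intro mult_mono power_mono) auto
    have "norm (v m j) \<le> (1 + norm x) * (C * \<rho> ^ m) * norm q ^ j"
      unfolding v_def using w[of 1] w[of x] by (intro norm_jackson_term_le) auto
    then have "norm (taylor m) * norm (v m j) \<le> norm (taylor m) * ((1 + norm x) * (C * \<rho> ^ m) * norm q ^ j)"
      by (intro mult_left_mono) auto
    then show ?thesis by (simp add: norm_mult mult_ac)
  qed
  then obtain T where T: "(\<lambda>j. \<Sum>m. taylor m * v m j) sums T" "(\<lambda>m. \<Sum>j. taylor m * v m j) sums T"
    by (rule sums_swap_product_bound[of "\<lambda>j m. taylor m * v m j"])
      (use \<rho> C summ q_less_1 in \<open>auto intro!: summable_mult summable_geometric\<close>)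
  have "(\<Sum>j. taylor m * v m j) = total_mass a b x * (\<Sum>n. u n m)" for m
    using sums_mult[OF v_sums[of m], of "taylor m"] unfolding col by (simp add: sums_iff mult_ac)
  then have "T = total_mass a b x * S"
    using T(2) sums_mult[OF S(2), of "total_mass a b x"] sums_unique2 by simp
  moreover have "(\<Sum>m. taylor m * v m j) = jackson_term q x 1 (\<lambda>t. weight a b x t * f t) j" for j
  proof -
    have f: "(\<lambda>m. taylor m * (t * q ^ j) ^ m) sums f (t * q ^ j)" if "t \<in> {1, x}" for t
      using node[OF that, of j] \<rho> by (intro taylor_sums) auto
    have "(\<lambda>m. 1 * q ^ j * (weight a b x (1 * q ^ j) * (taylor m * (1 * q ^ j) ^ m)) -
        x * q ^ j * (weight a b x (x * q ^ j) * (taylor m * (x * q ^ j) ^ m))) sums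
        jackson_term q x 1 (\<lambda>t. weight a b x t * f t) j"
      unfolding jackson_term_def by (intro sums_diff sums_mult f) auto
    then show ?thesis
      unfolding v_def jackson_term_def by (simp add: sums_iff algebra_simps)
  qed
  ultimately have "jackson_term q x 1 (\<lambda>t. weight a b x t * f t) sums (total_mass a b x * S)"
    using T(1) by simp
  moreover have "(\<lambda>n. A n * x ^ n * inner_sum n) sums S"
    using S(1) unfolding row .
  ultimately show thesis using that unfolding A_def by blast
qed

lemma lhs_term_eq:
  "lhs_term q f a b c n =
    qpoch a q n * qpoch b q n / (qpoch c q n * qpoch q q n) * (c / (a * b)) ^ n * inner_sum n"
  by (simp add: lhs_term_def qpochs_def inner_sum_def)

lemma lhs_domain_iff:
  "(a, b, c) \<in> lhs_domain q R \<longleftrightarrow> (a, b, c) \<in> param_region R \<and> qpoch_inf c q \<noteq> 0"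
  by (auto simp: lhs_domain_def qpochs_def qpoch_eq_0_iff[of c] qpoch_inf_eq_0_iff)

text \<open>Since $(zq^n;q)_\<infinity>$ divides $(z;q)_\<infinity>$, the conditions at all nodes follow from those at the
  two end points. Only finitely many conditions remain, so the domain is open.\<close>

lemma rhs_domain_iff:
  "(a, b, c) \<in> rhs_domain q R \<longleftrightarrow> (a, b, c) \<in> param_region R \<and> c \<noteq> 0 \<and>
     qpoch_inf (a * b * q / c) q \<noteq> 0 \<and> qpoch_inf (c / (a * b)) q \<noteq> 0 \<and> qpoch_inf c q \<noteq> 0 \<and>
     qpoch_inf a q \<noteq> 0 \<and> qpoch_inf b q \<noteq> 0 \<and> qpoch_inf (c / b) q \<noteq> 0 \<and> qpoch_inf (c / a) q \<noteq> 0"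
  (is "?L \<longleftrightarrow> ?R")
proof
  assume L: ?L
  then have ab: "a \<noteq> 0" "b \<noteq> 0" by (auto simp: rhs_domain_def param_region_def)
  have "\<forall>t\<in>{q ^ 0, c / (a * b) * q ^ 0}. qpochs_inf [a * t, b * t] q \<noteq> 0"
    using L unfolding rhs_domain_def by blast
  then show ?R
    using L ab by (simp add: rhs_domain_def qpochs_inf_def)
next
  assume R: ?R
  then have ab: "a \<noteq> 0" "b \<noteq> 0" by (auto simp: param_region_def)
  have "qpochs_inf [a * t, b * t] q \<noteq> 0" if "t \<in> {q ^ n, c / (a * b) * q ^ n}" for n t
  proof -
    have "qpoch_inf (z * q ^ n) q \<noteq> 0" if "z \<in> {a, b, c / a, c / b}" for z
      using that R qpoch_inf_power_nonzero by auto
    from this[of a] this[of b] this[of "c / a"] this[of "c / b"] that ab show ?thesis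
      by (auto simp: qpochs_inf_def mult_ac)
  qed
  then have "\<forall>n. \<forall>t\<in>{q ^ n, c / (a * b) * q ^ n}. qpochs_inf [a * t, b * t] q \<noteq> 0"
    by blast
  moreover have "qpochs_inf [q, a * b * q / c, c / (a * b), c] q \<noteq> 0"
    using R by (simp add: qpochs_inf_def)
  ultimately show ?L
    unfolding rhs_domain_def mem_Collect_eq prod.case using R by blast
qed

text \<open>With $x = c/(ab)$ the infinite products in front of the integral are the reciprocal of its total
  mass, by the Andrews--Askey evaluation.\<close>

lemma lhs_sums_rhs:
  assumes dom: "(a, b, c) \<in> rhs_domain q R"
  shows "jackson_integrable q (c / (a * b)) 1 (rhs_integrand q f a b c)"
    and "lhs_term q f a b c sums rhs q f a b c"
proof -
  define x where "x = c / (a * b)"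
  have ab: "a \<noteq> 0" "b \<noteq> 0" and c: "c \<noteq> 0" and x_R: "norm x < R"
    using dom unfolding rhs_domain_iff x_def by (auto simp: param_region_def)
  have ax: "a * x = c / b" and bx: "b * x = c / a" and abx: "a * b * x = c" and qx: "q / x = a * b * q / c"
    and x: "x \<noteq> 0"
    using ab c by (simp_all add: x_def)
  have nz: "qpoch_inf a q \<noteq> 0" "qpoch_inf b q \<noteq> 0" "qpoch_inf c q \<noteq> 0" "qpoch_inf x q \<noteq> 0"
    "qpoch_inf (q / x) q \<noteq> 0" "qpoch_inf (a * x) q \<noteq> 0" "qpoch_inf (b * x) q \<noteq> 0"
    using dom unfolding rhs_domain_iff x_def[symmetric] ax bx qx by auto
  have reg: "regular_params a b x"
    using nz x by (simp add: regular_params_def)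
  have integrand: "rhs_integrand q f a b c = (\<lambda>t. weight a b x t * f t)"
    using ab c by (auto simp: rhs_integrand_def weight_def qpochs_inf_def x_def mult_ac)
  obtain S where S: "lhs_term q f a b c sums S"
    "jackson_term q x 1 (\<lambda>t. weight a b x t * f t) sums (total_mass a b x * S)"
    using weighted_jackson_integral_expansion[OF reg _ x_R] nz(3)
    unfolding lhs_term_eq abx x_def[symmetric] by (metis (no_types, lifting) sums_cong)
  show "jackson_integrable q (c / (a * b)) 1 (rhs_integrand q f a b c)"
    using S(2) unfolding jackson_integrable_def integrand x_def[symmetric] by (rule sums_summable)
  have "jackson_integral q x 1 (\<lambda>t. weight a b x t * f t) = total_mass a b x * S"
    using sums_unique[OF S(2)] jackson_integral_def by metis
  then have "rhs q f a b c =
      qpoch_inf a q * qpoch_inf (a * x) q * qpoch_inf b q * qpoch_inf (b * x) q * total_mass a b x /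
      (qpoch_inf c q * qpoch_inf q q * qpoch_inf x q * qpoch_inf (q / x) q) * S"
    unfolding rhs_def integrand x_def[symmetric] qx[symmetric] ax[symmetric] bx[symmetric]
    by (simp add: qpochs_inf_def mult_ac)
  also have "\<dots> = S"
    unfolding andrews_askey[OF reg nz(4,5)] abx using nz by simp
  finally show "lhs_term q f a b c sums rhs q f a b c" using S(1) by simp
qed

end

section \<open>Series of holomorphic functions of three variables\<close>

lemma holomorphic3_on_subset: "holomorphic3_on F U \<Longrightarrow> V \<subseteq> U \<Longrightarrow> holomorphic3_on F V"
  unfolding holomorphic3_on_def by blast

lemma holomorphic3_on_cong:
  assumes "open U" "\<And>p. p \<in> U \<Longrightarrow> F p = G p" "holomorphic3_on G U"
  shows "holomorphic3_on F U"
  unfolding holomorphic3_on_def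
proof
  fix p assume p: "p \<in> U"
  then obtain A B C where "(G has_derivative (\<lambda>(x, y, z). A * x + B * y + C * z)) (at p)"
    using assms(3) unfolding holomorphic3_on_def by blast
  then have "(F has_derivative (\<lambda>(x, y, z). A * x + B * y + C * z)) (at p)"
    by (rule has_derivative_transform_within_open[OF _ assms(1) p]) (simp add: assms(2))
  then show "\<exists>A B C. (F has_derivative (\<lambda>(x, y, z). A * x + B * y + C * z)) (at p)" by blast
qed

lemma holomorphic3_on_const: "holomorphic3_on (\<lambda>p. k) U"
  unfolding holomorphic3_on_def
proof
  fix p :: "complex \<times> complex \<times> complex"
  have "((\<lambda>p. k) has_derivative (\<lambda>(x, y, z). 0 * x + 0 * y + 0 * z)) (at p)"
    by (rule has_derivative_eq_rhs[OF has_derivative_const]) auto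
  then show "\<exists>A B C. ((\<lambda>p. k) has_derivative (\<lambda>(x, y, z). A * x + B * y + C * z)) (at p)"
    by blast
qed

lemma holomorphic3_on_mult:
  assumes "holomorphic3_on F U" "holomorphic3_on G U"
  shows "holomorphic3_on (\<lambda>p. F p * G p) U"
  unfolding holomorphic3_on_def
proof
  fix p assume p: "p \<in> U"
  obtain A B C where 1: "(F has_derivative (\<lambda>(x, y, z). A * x + B * y + C * z)) (at p)"
    using assms(1) p unfolding holomorphic3_on_def by blast
  obtain A' B' C' where 2: "(G has_derivative (\<lambda>(x, y, z). A' * x + B' * y + C' * z)) (at p)"
    using assms(2) p unfolding holomorphic3_on_def by blast
  have "((\<lambda>p. F p * G p) has_derivative (\<lambda>(x, y, z). (F p * A' + A * G p) * x +
      (F p * B' + B * G p) * y + (F p * C' + C * G p) * z)) (at p)"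
    by (rule has_derivative_eq_rhs[OF has_derivative_mult[OF 1 2]])
      (auto simp: fun_eq_iff algebra_simps)
  then show "\<exists>A B C. ((\<lambda>p. F p * G p) has_derivative (\<lambda>(x, y, z). A * x + B * y + C * z)) (at p)"
    by blast
qed

lemma holomorphic3_on_power: "holomorphic3_on F U \<Longrightarrow> holomorphic3_on (\<lambda>p. F p ^ n) U"
  by (induction n) (auto intro: holomorphic3_on_const holomorphic3_on_mult)

lemma holomorphic3_on_coordinate:
  assumes g: "g holomorphic_on S" "open S"
  shows "(\<And>p. p \<in> U \<Longrightarrow> fst p \<in> S) \<Longrightarrow> holomorphic3_on (\<lambda>p. g (fst p)) U"
    and "(\<And>p. p \<in> U \<Longrightarrow> fst (snd p) \<in> S) \<Longrightarrow> holomorphic3_on (\<lambda>p. g (fst (snd p))) U"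
    and "(\<And>p. p \<in> U \<Longrightarrow> snd (snd p) \<in> S) \<Longrightarrow> holomorphic3_on (\<lambda>p. g (snd (snd p))) U"
proof -
  have comp: "\<exists>A B C. ((\<lambda>p. g (\<pi> p)) has_derivative (\<lambda>(x, y, z). A * x + B * y + C * z)) (at p)"
    if "bounded_linear \<pi>" "\<pi> p \<in> S" "\<pi> = (\<lambda>(x, y, z). \<alpha> * x + \<beta> * y + \<gamma> * z)"
    for \<pi> :: "complex \<times> complex \<times> complex \<Rightarrow> complex" and p \<alpha> \<beta> \<gamma>
  proof -
    have "(\<pi> has_derivative \<pi>) (at p)"
      using that(1) by (rule bounded_linear_imp_has_derivative)
    moreover have "(g has_derivative (*) (deriv g (\<pi> p))) (at (\<pi> p))"
      using holomorphic_derivI[OF g that(2)] by (simp add: has_field_derivative_def)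
    ultimately have D: "((\<lambda>p. g (\<pi> p)) has_derivative (\<lambda>h. deriv g (\<pi> p) * \<pi> h)) (at p)"
      by (rule has_derivative_compose)
    have "(\<lambda>h. deriv g (\<pi> p) * \<pi> h) =
        (\<lambda>(x, y, z). deriv g (\<pi> p) * \<alpha> * x + deriv g (\<pi> p) * \<beta> * y + deriv g (\<pi> p) * \<gamma> * z)"
      by (subst (2) that(3)) (simp add: fun_eq_iff algebra_simps)
    with D show ?thesis by metis
  qed
  show "holomorphic3_on (\<lambda>p. g (fst p)) U" if "\<And>p. p \<in> U \<Longrightarrow> fst p \<in> S"
    unfolding holomorphic3_on_def using that
    by (intro ballI comp[of _ _ 1 0 0]) (auto intro: bounded_linear_fst)
  show "holomorphic3_on (\<lambda>p. g (fst (snd p))) U" if "\<And>p. p \<in> U \<Longrightarrow> fst (snd p) \<in> S"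
    unfolding holomorphic3_on_def using that
    by (intro ballI comp[of "\<lambda>p. fst (snd p)" _ 0 1 0])
      (auto intro: bounded_linear_compose[OF bounded_linear_fst bounded_linear_snd])
  show "holomorphic3_on (\<lambda>p. g (snd (snd p))) U" if "\<And>p. p \<in> U \<Longrightarrow> snd (snd p) \<in> S"
    unfolding holomorphic3_on_def using that
    by (intro ballI comp[of "\<lambda>p. snd (snd p)" _ 0 0 1])
      (auto intro: bounded_linear_compose[OF bounded_linear_snd bounded_linear_snd])
qed

definition dir_deriv :: "(complex \<times> complex \<times> complex \<Rightarrow> complex) \<Rightarrow> complex \<times> complex \<times> complex \<Rightarrow>
    complex \<times> complex \<times> complex \<Rightarrow> complex" where
  "dir_deriv F p = frechet_derivative F (at p)"

lemma holomorphic3_onE: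
  assumes "holomorphic3_on F U" "p \<in> U"
  obtains A B C where "(F has_derivative dir_deriv F p) (at p)"
    "dir_deriv F p = (\<lambda>(x, y, z). A * x + B * y + C * z)"
proof -
  obtain A B C where *: "(F has_derivative (\<lambda>(x, y, z). A * x + B * y + C * z)) (at p)"
    using assms unfolding holomorphic3_on_def by blast
  then have "dir_deriv F p = (\<lambda>(x, y, z). A * x + B * y + C * z)"
    unfolding dir_deriv_def using frechet_derivative_at by metis
  with * show thesis using that by metis
qed

text \<open>The one-variable Cauchy inequality on the complex line through $w$ in the direction $h$.\<close>

lemma Cauchy_inequality_direction:
  assumes hol: "holomorphic3_on F (ball w r)" and r: "0 < r"
    and bound: "\<And>v. v \<in> ball w r \<Longrightarrow> norm (F v) \<le> M"
  shows "norm (dir_deriv F w h) \<le> 2 * M / r * norm h"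
proof (cases "h = 0")
  case True
  obtain A B C where "dir_deriv F w = (\<lambda>(x, y, z). A * x + B * y + C * z)"
    using holomorphic3_onE[OF hol, of w] r by (metis centre_in_ball)
  then show ?thesis using True by (simp add: zero_prod_def)
next
  case False
  obtain x y z where h: "h = (x, y, z)" by (cases h)
  define line where "line s = w + (s * x, s * y, s * z)" for s
  have norm_line: "norm (s * x, s * y, s * z) = norm s * norm h" for s
    unfolding h norm_Pair
    by (simp add: norm_mult power_mult_distrib real_sqrt_mult flip: distrib_left)
  \<comment> \<open>The line leaves the ball at parameters of modulus $r/|h|$; half of this keeps the closed disc inside.\<close>
  define \<delta> where "\<delta> = r / (2 * norm h)"
  have \<delta>: "0 < \<delta>" "\<delta> * norm h < r"
    using r False by (simp_all add: \<delta>_def)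
  have in_ball: "line s \<in> ball w r" if "norm s \<le> \<delta>" for s
  proof -
    have "norm s * norm h \<le> \<delta> * norm h" using that by (rule mult_right_mono) simp
    moreover have "dist w (line s) = norm s * norm h"
      by (subst dist_commute) (simp only: line_def dist_norm add_diff_cancel_left' norm_line)
    ultimately show ?thesis using \<delta>(2) by simp
  qed
  have deriv_line: "((\<lambda>s. F (line s)) has_field_derivative dir_deriv F (line s) h) (at s)"
    if s: "norm s \<le> \<delta>" for s
  proof -
    obtain A B C where ABC: "(F has_derivative dir_deriv F (line s)) (at (line s))"
      "dir_deriv F (line s) = (\<lambda>(x, y, z). A * x + B * y + C * z)"
      using holomorphic3_onE[OF hol in_ball[OF s]] by metis
    have "(line has_derivative (\<lambda>s. 0 + (s * x, s * y, s * z))) (at s)"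
      unfolding line_def
      by (intro has_derivative_add has_derivative_const has_derivative_Pair
          has_derivative_mult_left has_derivative_ident)
    then have "(line has_derivative (\<lambda>s. (s * x, s * y, s * z))) (at s)"
      by (simp only: add_0_left)
    then have "((\<lambda>s. F (line s)) has_derivative (\<lambda>u. dir_deriv F (line s) (u * x, u * y, u * z))) (at s)"
      by (rule has_derivative_compose) (rule ABC(1))
    then show ?thesis
      unfolding has_field_derivative_def ABC(2) h
      by (rule has_derivative_eq_rhs) (simp add: fun_eq_iff algebra_simps)
  qed
  have "norm ((deriv ^^ 1) (\<lambda>s. F (line s)) 0) \<le> fact 1 * M / \<delta> ^ 1"
  proof (rule Cauchy_inequality)
    show "(\<lambda>s. F (line s)) holomorphic_on ball 0 \<delta>"
      unfolding holomorphic_on_open[OF open_ball] using deriv_line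
      by (metis mem_ball_0 less_imp_le)
    show "continuous_on (cball 0 \<delta>) (\<lambda>s. F (line s))"
      by (intro continuous_at_imp_continuous_on ballI DERIV_isCont[OF deriv_line]) simp
    show "norm (F (line s)) \<le> M" if "norm (0 - s) = \<delta>" for s
      using that by (intro bound in_ball) simp
  qed (rule \<delta>)
  moreover have "deriv (\<lambda>s. F (line s)) 0 = dir_deriv F w h"
    using DERIV_imp_deriv[OF deriv_line[of 0]] \<delta> by (simp add: line_def flip: zero_prod_def)
  ultimately show ?thesis using r False by (simp add: \<delta>_def field_simps)
qed

text \<open>By Cauchy's inequality the derivatives inherit a summable bound on the ball of half the radius,
  so the series may be differentiated term by term.\<close>

lemma holomorphic3_on_suminf:
  assumes hol: "\<And>n. holomorphic3_on (T n) U"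
    and bound: "\<And>p. p \<in> U \<Longrightarrow> \<exists>r>0. \<exists>M. ball p r \<subseteq> U \<and> summable M \<and>
      (\<forall>n. \<forall>w\<in>ball p r. norm (T n w) \<le> M n)"
  shows "holomorphic3_on (\<lambda>p. \<Sum>n. T n p) U"
  unfolding holomorphic3_on_def
proof
  fix p assume p: "p \<in> U"
  obtain r M where r: "0 < r" "ball p r \<subseteq> U" and M: "summable M"
    and le: "\<And>n w. w \<in> ball p r \<Longrightarrow> norm (T n w) \<le> M n"
    using bound[OF p] by blast
  let ?S = "ball p (r / 2)"
  define N where "N n = 2 * M n / (r / 2)" for n
  have N: "summable N"
    unfolding N_def using M by (intro summable_divide summable_mult)
  have deriv: "(T n has_derivative dir_deriv (T n) w) (at w)" if "w \<in> ?S" for n w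
  proof -
    have "w \<in> U" using that r by auto
    then show ?thesis using holomorphic3_onE[OF hol[of n]] by metis
  qed
  have deriv_le: "norm (dir_deriv (T n) w h) \<le> N n * norm h" if w: "w \<in> ?S" for n w h
  proof -
    have sub: "ball w (r / 2) \<subseteq> ball p r"
    proof
      fix v assume "v \<in> ball w (r / 2)"
      then show "v \<in> ball p r"
        using w dist_triangle[of p v w] by simp
    qed
    show ?thesis unfolding N_def
      using sub r le holomorphic3_on_subset[OF hol[of n]] by (intro Cauchy_inequality_direction) auto
  qed
  have summ: "summable (\<lambda>n. dir_deriv (T n) w h)" if "w \<in> ?S" for w h
    by (rule summable_comparison_test'[of "\<lambda>n. N n * norm h" 0])
      (use N deriv_le[OF that] in \<open>auto intro: summable_mult2\<close>)
  have tail: "\<forall>\<^sub>F n in sequentially. \<forall>w\<in>?S. \<forall>h.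
      norm ((\<Sum>i<n. dir_deriv (T i) w h) - (\<Sum>i. dir_deriv (T i) w h)) \<le> e * norm h" if "0 < e" for e
  proof -
    obtain k where k: "\<And>n. n \<ge> k \<Longrightarrow> norm (\<Sum>i. N (i + n)) < e"
      using suminf_exist_split[OF \<open>0 < e\<close> N] by blast
    have "norm ((\<Sum>i<n. dir_deriv (T i) w h) - (\<Sum>i. dir_deriv (T i) w h)) \<le> e * norm h"
      if "n \<ge> k" "w \<in> ?S" for n w h
    proof -
      have sN: "summable (\<lambda>i. N (i + n))" using N by (rule summable_ignore_initial_segment)
      have "norm ((\<Sum>i<n. dir_deriv (T i) w h) - (\<Sum>i. dir_deriv (T i) w h)) =
          norm (\<Sum>i. dir_deriv (T (i + n)) w h)"
        unfolding suminf_split_initial_segment[OF summ[OF that(2), of h], of n] by simp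
      also have "\<dots> \<le> (\<Sum>i. N (i + n) * norm h)"
        by (intro norm_suminf_le summable_mult2 sN deriv_le that)
      also have "\<dots> = (\<Sum>i. N (i + n)) * norm h"
        using sN by (rule suminf_mult2[symmetric])
      also have "\<dots> \<le> e * norm h"
        using k[OF that(1)] by (intro mult_right_mono) auto
      finally show ?thesis .
    qed
    then show ?thesis unfolding eventually_sequentially by blast
  qed
  have pS: "p \<in> ?S" using r by simp
  have "summable (\<lambda>n. T n p)"
    by (rule summable_comparison_test'[OF M, of 0]) (use le r in auto)
  then have p_sums: "(\<lambda>n. T n p) sums (\<Sum>n. T n p)" by (rule summable_sums)
  have "\<exists>g. \<forall>w\<in>?S. (\<lambda>n. T n w) sums g w \<and>
      (g has_derivative (\<lambda>h. \<Sum>n. dir_deriv (T n) w h)) (at w within ?S)"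
    by (rule has_derivative_series[where f' = "\<lambda>n w. dir_deriv (T n) w"])
      (use convex_ball tail pS p_sums deriv has_derivative_at_withinI in blast)+
  then obtain g where g: "\<And>w. w \<in> ?S \<Longrightarrow> (\<lambda>n. T n w) sums g w"
    "\<And>w. w \<in> ?S \<Longrightarrow> (g has_derivative (\<lambda>h. \<Sum>n. dir_deriv (T n) w h)) (at w within ?S)"
    by blast
  have "(g has_derivative (\<lambda>h. \<Sum>n. dir_deriv (T n) p h)) (at p)"
    using g(2)[OF pS] at_within_open[OF pS open_ball] by simp
  then have D: "((\<lambda>p. \<Sum>n. T n p) has_derivative (\<lambda>h. \<Sum>n. dir_deriv (T n) p h)) (at p)"
    by (rule has_derivative_transform_within_open[OF _ open_ball pS]) (use g(1) in \<open>simp add: sums_iff\<close>)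
  have "\<exists>A B C. dir_deriv (T n) p = (\<lambda>(x, y, z). A * x + B * y + C * z)" for n
    using holomorphic3_onE[OF hol p] by metis
  then obtain A B C where ABC: "\<And>n. dir_deriv (T n) p = (\<lambda>(x, y, z). A n * x + B n * y + C n * z)"
    by metis
  have "summable A" "summable B" "summable C"
    using summ[OF pS, of "(1, 0, 0)"] summ[OF pS, of "(0, 1, 0)"] summ[OF pS, of "(0, 0, 1)"]
    unfolding ABC by simp_all
  then have "(\<lambda>n. A n * x + B n * y + C n * z) sums (suminf A * x + suminf B * y + suminf C * z)" for x y z
    by (intro sums_add sums_mult2 summable_sums)
  then have "(\<lambda>h. \<Sum>n. dir_deriv (T n) p h) = (\<lambda>(x, y, z). suminf A * x + suminf B * y + suminf C * z)"
    unfolding ABC by (auto simp: fun_eq_iff sums_iff)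
  with D show "\<exists>A B C. ((\<lambda>p. \<Sum>n. T n p) has_derivative (\<lambda>(x, y, z). A * x + B * y + C * z)) (at p)"
    by metis
qed

text \<open>A global representation as a quotient serves near every point, and the density of $S$ prevents
  the denominator from vanishing identically on a ball. Holomorphy of $1/H$ is assumed separately because
  it is immediate in the application, where $H$ depends on one variable.\<close>

lemma meromorphic3_on_quotient:
  assumes D: "open D" "open S" "S \<subseteq> D" "D \<subseteq> closure S"
    and G: "holomorphic3_on G D" and H: "holomorphic3_on H D" and H': "holomorphic3_on (\<lambda>p. inverse (H p)) S"
    and F: "\<And>p. p \<in> S \<Longrightarrow> F p = G p / H p" "\<And>p. p \<in> S \<Longrightarrow> H p \<noteq> 0"
  shows "meromorphic3_on F S D"
  unfolding meromorphic3_on_def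
proof (intro conjI ballI)
  show "holomorphic3_on F S"
  proof (rule holomorphic3_on_cong[OF D(2)])
    show "F p = G p * inverse (H p)" if "p \<in> S" for p
      using F(1)[OF that] by (simp add: divide_inverse)
    show "holomorphic3_on (\<lambda>p. G p * inverse (H p)) S"
      using D(3) G H' holomorphic3_on_subset by (intro holomorphic3_on_mult) blast+
  qed
  fix p assume p: "p \<in> D"
  then obtain e where e: "0 < e" "ball p e \<subseteq> D"
    using D(1) open_contains_ball by blast
  have "ball p e \<inter> S \<noteq> {}"
    using p D(4) e(1) open_Int_closure_eq_empty[of "ball p e" S] centre_in_ball[of p e] by blast
  then have "\<exists>w\<in>ball p e. H w \<noteq> 0" using F(2) by blast
  then show "\<exists>U G H. open U \<and> connected U \<and> p \<in> U \<and> U \<subseteq> D \<and>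
      holomorphic3_on G U \<and> holomorphic3_on H U \<and> (\<exists>w\<in>U. H w \<noteq> 0) \<and>
      (\<forall>w\<in>U \<inter> S. H w \<noteq> 0 \<longrightarrow> F w = G w / H w)"
    using e F(1) holomorphic3_on_subset[OF G e(2)] holomorphic3_on_subset[OF H e(2)]
    by (intro exI[of _ "ball p e"] exI[of _ G] exI[of _ H] conjI) (simp_all add: connected_ball)
qed (use D in auto)

section \<open>Meromorphy in the parameters\<close>

lemma open_minus_countable_complex:
  fixes A :: "complex set"
  assumes "open A" "x \<in> A" "countable Z"
  obtains y where "y \<in> A" "y \<notin> Z"
proof -
  obtain e where e: "0 < e" "ball x e \<subseteq> A"
    using assms(1,2) open_contains_ball by blast
  have "\<not> ball x e \<subseteq> Z"
    using countable_subset[OF _ assms(3)] uncountable_ball[OF e(1), of x] by blast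
  then show thesis using that e(2) by blast
qed

context q_taylor
begin

lemma open_param_region: "open (param_region r)"
proof -
  have "param_region r = {p. fst p \<noteq> 0 \<and> fst (snd p) \<noteq> 0 \<and>
      norm (snd (snd p)) < r * norm (fst p * fst (snd p))}"
    by (auto simp: param_region_def norm_divide norm_mult field_simps)
  also have "open \<dots>"
    by (intro open_Collect_conj open_Collect_neq open_Collect_less continuous_intros)
  finally show ?thesis .
qed

lemma lhs_domain_eq: "lhs_domain q R = param_region R \<inter> (\<lambda>p. qpoch_inf (snd (snd p)) q) -` (- {0})"
  by (auto simp: lhs_domain_iff)

lemma open_lhs_domain: "open (lhs_domain q R)"
  unfolding lhs_domain_eq
  by (intro continuous_open_preimage continuous_intros open_param_region)

lemma rhs_domain_subset: "rhs_domain q R \<subseteq> lhs_domain q R"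
  by (auto simp: lhs_domain_iff rhs_domain_iff)

lemma open_rhs_domain: "open (rhs_domain q R)"
proof -
  define W where "W = param_region R \<inter> {p. snd (snd p) \<noteq> 0}"
  define h where "h p = qpoch_inf (fst p * fst (snd p) * q / snd (snd p)) q *
      qpoch_inf (snd (snd p) / (fst p * fst (snd p))) q * qpoch_inf (snd (snd p)) q *
      (qpoch_inf (fst p) q * qpoch_inf (fst (snd p)) q *
      (qpoch_inf (snd (snd p) / fst (snd p)) q * qpoch_inf (snd (snd p) / fst p) q))" for p
  have "rhs_domain q R = W \<inter> h -` (- {0})"
    by (auto simp: rhs_domain_iff W_def h_def)
  moreover have "open W"
    unfolding W_def by (intro open_Int open_param_region open_Collect_neq continuous_intros)
  moreover have "continuous_on W h"
    unfolding h_def by (intro continuous_intros) (auto simp: W_def param_region_def)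
  ultimately show ?thesis
    using continuous_open_preimage[of W h "- {0}"] by (simp add: open_Compl)
qed

lemma countable_qpoch_inf_zeros: "countable {z. qpoch_inf z q = 0}"
proof (rule countable_subset)
  show "{z. qpoch_inf z q = 0} \<subseteq> range (\<lambda>j. inverse (q ^ j))"
    using q_nonzero by (auto simp: qpoch_inf_eq_0_iff field_simps image_iff)
qed simp

text \<open>Apart from those with $c = 0$, the excluded parameters are zeros of $(z;q)_\<infinity>$ for finitely many Laurent monomials $z$ in $a,b,c$, and the
  zero set is countable. Choose $a$, then $b$, then $c$ near the given values, each outside a
  countable set.\<close>

lemma param_region_subset_closure: "param_region R \<subseteq> closure (rhs_domain q R)"
proof
  fix p assume p: "p \<in> param_region R"
  let ?Z = "{z. qpoch_inf z q = 0}"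
  show "p \<in> closure (rhs_domain q R)"
  proof (rule ccontr)
    assume "p \<notin> closure (rhs_domain q R)"
    then obtain U where U: "open U" "p \<in> U" "U \<inter> rhs_domain q R = {}"
      using closure_subset[of "rhs_domain q R"] open_Compl[OF closed_closure[of "rhs_domain q R"]] by blast
    have "open (U \<inter> param_region R)" "p \<in> U \<inter> param_region R"
      using U p open_param_region by auto
    then obtain A BC where A: "open A" "fst p \<in> A" and BC: "open BC" "snd p \<in> BC"
      and "A \<times> BC \<subseteq> U \<inter> param_region R"
      by (metis open_prod_elim mem_Times_iff)
    moreover obtain B C where B: "open B" "fst (snd p) \<in> B" and C: "open C" "snd (snd p) \<in> C"
      and "B \<times> C \<subseteq> BC"
      using BC by (metis open_prod_elim mem_Times_iff)
    ultimately have box: "A \<times> B \<times> C \<subseteq> U \<inter> param_region R" by blast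
    obtain a where a: "a \<in> A" "a \<notin> ?Z"
      using open_minus_countable_complex[OF A countable_qpoch_inf_zeros] .
    obtain b where b: "b \<in> B" "b \<notin> ?Z"
      using open_minus_countable_complex[OF B countable_qpoch_inf_zeros] .
    have "countable (insert 0 (?Z \<union> (\<lambda>z. a * b * q / z) ` ?Z \<union> (\<lambda>z. z * (a * b)) ` ?Z \<union>
        (\<lambda>z. z * a) ` ?Z \<union> (\<lambda>z. z * b) ` ?Z))" (is "countable ?bad")
      using countable_qpoch_inf_zeros by simp
    then obtain c where c: "c \<in> C" "c \<notin> ?bad"
      using open_minus_countable_complex[OF C] by blast
    have in_box: "(a, b, c) \<in> U" "(a, b, c) \<in> param_region R"
      using box a b c by auto
    then have ab: "a \<noteq> 0" "b \<noteq> 0" by (auto simp: param_region_def)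
    have c0: "c \<noteq> 0" using c by simp
    have "qpoch_inf (a * b * q / c) q \<noteq> 0"
    proof
      assume "qpoch_inf (a * b * q / c) q = 0"
      moreover have "c = a * b * q / (a * b * q / c)" using ab c0 q_nonzero by simp
      ultimately show False using c(2) by blast
    qed
    moreover have "qpoch_inf (c / d) q \<noteq> 0" if "d \<noteq> 0" "c \<notin> (\<lambda>z. z * d) ` ?Z" for d
    proof
      assume "qpoch_inf (c / d) q = 0"
      moreover have "c = c / d * d" using that(1) by simp
      ultimately show False using that(2) by blast
    qed
    ultimately have "(a, b, c) \<in> rhs_domain q R"
      unfolding rhs_domain_iff using in_box(2) ab c0 a(2) b(2) c(2) by simp
    with in_box(1) U(3) show False by blast
  qed
qed

text \<open>The terms of the left-hand side multiplied by $(c;q)_\<infinity>$, which cancels the denominator $(c;q)_n$ and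
  leaves $(cq^n;q)_\<infinity>$. They have no poles in the whole region, also not at $c = 0$.\<close>

definition regularized_term :: "nat \<Rightarrow> complex \<times> complex \<times> complex \<Rightarrow> complex" where
  "regularized_term n p = qpoch (fst p) q n * (qpoch (fst (snd p)) q n *
     (qpoch_inf (snd (snd p) * q ^ n) q *
     ((snd (snd p) * (inverse (fst p) * inverse (fst (snd p)))) ^ n *
     (inner_sum n / qpoch q q n))))"

lemma regularized_term_eq:
  assumes "qpoch_inf c q \<noteq> 0"
  shows "regularized_term n (a, b, c) = qpoch_inf c q * lhs_term q f a b c n"
  using assms qpoch_inf_split[of c n]
  by (simp add: regularized_term_def lhs_term_eq divide_inverse power_mult_distrib mult_ac)

lemma holomorphic_regularized_term: "holomorphic3_on (regularized_term n) (param_region R)"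
proof -
  have poly: "(\<lambda>z. qpoch z q n) holomorphic_on UNIV"
    unfolding qpoch_def by (intro holomorphic_intros)
  have inf: "(\<lambda>z. qpoch_inf (z * q ^ n) q) holomorphic_on UNIV"
    using holomorphic_on_compose[of "\<lambda>z. z * q ^ n" UNIV, OF _ qpoch_inf_holomorphic]
    by (simp add: o_def holomorphic_intros)
  have inv: "inverse holomorphic_on - {0 :: complex}"
    by (intro holomorphic_intros) auto
  have id: "(\<lambda>z::complex. z) holomorphic_on UNIV"
    by (intro holomorphic_intros)
  show ?thesis
    unfolding regularized_term_def
    by (intro holomorphic3_on_mult holomorphic3_on_power holomorphic3_on_const
        holomorphic3_on_coordinate(1)[OF poly] holomorphic3_on_coordinate(2)[OF poly]
        holomorphic3_on_coordinate(3)[OF inf] holomorphic3_on_coordinate(3)[OF id]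
        holomorphic3_on_coordinate(1)[OF inv] holomorphic3_on_coordinate(2)[OF inv])
      (auto simp: param_region_def)
qed

lemma regularized_term_locally_bounded:
  assumes p: "p \<in> param_region R"
  shows "\<exists>r>0. \<exists>M. ball p r \<subseteq> param_region R \<and> summable M \<and>
    (\<forall>n. \<forall>w\<in>ball p r. norm (regularized_term n w) \<le> M n)"
proof -
  obtain a0 b0 c0 where p_eq: "p = (a0, b0, c0)" by (cases p)
  have "max 1 (norm (c0 / (a0 * b0))) < R"
    using p R_gt_1 by (simp add: p_eq param_region_def)
  then obtain \<sigma> where \<sigma>: "max 1 (norm (c0 / (a0 * b0))) < \<sigma>" "\<sigma> < R" using dense by blast
  \<comment> \<open>Near $p$ the powers of $c/(ab)$ grow at most like $\<sigma>^n$, while the inner sums decay like $\<rho>^{-n}$.\<close>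
  obtain \<rho> where \<rho>: "\<sigma> < \<rho>" "\<rho> < R" using dense[OF \<sigma>(2)] by blast
  define V where "V = param_region \<sigma> \<inter> {w. norm (fst w) < norm a0 + 1} \<inter>
      {w. norm (fst (snd w)) < norm b0 + 1} \<inter> {w. norm (snd (snd w)) < norm c0 + 1}"
  have "open V"
    unfolding V_def by (intro open_Int open_param_region open_Collect_less continuous_intros)
  moreover have "p \<in> V"
    using p \<sigma>(1) by (auto simp: V_def p_eq param_region_def)
  ultimately obtain r where r: "0 < r" "ball p r \<subseteq> V"
    using open_contains_ball by blast
  obtain C where C: "0 \<le> C" "\<And>n. norm (inner_sum n) \<le> C * (1 / \<rho>) ^ n"
    using inner_sum_bound[of \<rho>] \<sigma> \<rho> by auto
  obtain K where K: "0 < K" "\<And>n. norm (inverse (qpoch q q n)) \<le> K"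
    using inverse_qpoch_bounded[OF qpoch_inf_q_nonzero] by blast
  define E where "E z = exp ((norm z + 1) / (1 - norm q))" for z :: complex
  have E_le: "exp (norm w / (1 - norm q)) \<le> E z" if "norm w \<le> norm z + 1" for w z :: complex
    using that q_less_1 by (simp add: E_def divide_right_mono)
  define M where "M n = E a0 * (E b0 * (E c0 * (\<sigma> ^ n * (C * (1 / \<rho>) ^ n * K))))" for n
  have "M = (\<lambda>n. E a0 * E b0 * E c0 * C * K * (\<sigma> / \<rho>) ^ n)"
    by (simp add: M_def fun_eq_iff power_divide)
  then have "summable M"
    using \<sigma> \<rho> by (auto intro!: summable_mult summable_geometric)
  moreover have "norm (regularized_term n w) \<le> M n" if w: "w \<in> ball p r" for n w
  proof -
    obtain a b c where w_eq: "w = (a, b, c)" by (cases w)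
    have bounds: "norm a \<le> norm a0 + 1" "norm b \<le> norm b0 + 1" "norm c \<le> norm c0 + 1"
      "norm (c / (a * b)) \<le> \<sigma>"
      using w r(2) by (auto simp: w_eq V_def param_region_def subset_iff less_imp_le)
    have "norm c * norm q ^ n \<le> norm c * 1"
      using q_less_1 by (intro mult_left_mono power_le_one) auto
    then have cq: "norm (c * q ^ n) \<le> norm c0 + 1"
      using bounds(3) by (simp add: norm_mult norm_power)
    have x: "norm (c * (inverse a * inverse b)) \<le> \<sigma>"
      using bounds(4) by (simp add: divide_inverse)
    have "norm (qpoch a q n) \<le> E a0" "norm (qpoch b q n) \<le> E b0" "norm (qpoch_inf (c * q ^ n) q) \<le> E c0"
      using norm_qpoch_le norm_qpoch_inf_le E_le bounds(1,2) cq by (meson order_trans)+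
    moreover have "norm (inner_sum n / qpoch q q n) \<le> C * (1 / \<rho>) ^ n * K"
      unfolding divide_inverse[of "inner_sum n"] norm_mult using C K \<sigma> \<rho> by (intro mult_mono) auto
    moreover have "norm (c * (inverse a * inverse b)) ^ n \<le> \<sigma> ^ n"
      using x by (intro power_mono) auto
    ultimately show ?thesis
      unfolding w_eq regularized_term_def M_def fst_conv snd_conv norm_mult[of "qpoch _ _ _"]
        norm_mult[of "qpoch_inf _ _"] norm_mult[of "_ ^ _"] norm_power
      using \<sigma> by (intro mult_mono mult_nonneg_nonneg) (auto simp: E_def)
  qed
  moreover have "V \<subseteq> param_region R"
    using \<sigma>(2) by (auto simp: V_def param_region_def)
  ultimately show ?thesis using r by blast
qed

lemma summable_lhs_term:
  assumes "(a, b, c) \<in> lhs_domain q R"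
  shows "summable (lhs_term q f a b c)"
    and "(\<Sum>n. lhs_term q f a b c n) = (\<Sum>n. regularized_term n (a, b, c)) / qpoch_inf c q"
proof -
  have c: "qpoch_inf c q \<noteq> 0" and p: "(a, b, c) \<in> param_region R"
    using assms by (auto simp: lhs_domain_iff)
  obtain r M where rM: "0 < r" "summable M" "\<And>n w. w \<in> ball (a, b, c) r \<Longrightarrow> norm (regularized_term n w) \<le> M n"
    using regularized_term_locally_bounded[OF p] by blast
  have summ: "summable (\<lambda>n. regularized_term n (a, b, c))"
    by (rule summable_comparison_test'[OF rM(2)]) (rule rM(3), simp add: rM(1))
   have eq: "lhs_term q f a b c = (\<lambda>n. regularized_term n (a, b, c) / qpoch_inf c q)"
    using regularized_term_eq[OF c] c by (simp add: fun_eq_iff)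
  show "summable (lhs_term q f a b c)"
    unfolding eq using summ by (rule summable_divide)
  show "(\<Sum>n. lhs_term q f a b c n) = (\<Sum>n. regularized_term n (a, b, c)) / qpoch_inf c q"
    unfolding eq using summ by (rule suminf_divide)
qed

text \<open>The left-hand side is the series of regularized terms divided by $(c;q)_\<infinity>$. The statement allows any
  dense open $S$ in its domain because the right-hand side is the same function on a smaller set;
  this also settles the behaviour of the right-hand side at $c = 0$, where its formula has no meaning.\<close>

lemma meromorphic_lhs_on:
  assumes S: "open S" "S \<subseteq> lhs_domain q R" "param_region R \<subseteq> closure S"
    and F: "\<And>a b c. (a, b, c) \<in> S \<Longrightarrow> F (a, b, c) = (\<Sum>n. lhs_term q f a b c n)"
  shows "meromorphic3_on F S (param_region R)"
proof (rule meromorphic3_on_quotient)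
  show "holomorphic3_on (\<lambda>p. \<Sum>n. regularized_term n p) (param_region R)"
    by (rule holomorphic3_on_suminf[OF holomorphic_regularized_term regularized_term_locally_bounded])
  show "holomorphic3_on (\<lambda>p. qpoch_inf (snd (snd p)) q) (param_region R)"
    by (rule holomorphic3_on_coordinate(3)[OF qpoch_inf_holomorphic open_UNIV]) simp
  have nz: "qpoch_inf (snd (snd p)) q \<noteq> 0" if "p \<in> S" for p
    using S(2) that by (auto simp: lhs_domain_eq)
  then show "\<And>p. p \<in> S \<Longrightarrow> qpoch_inf (snd (snd p)) q \<noteq> 0" .
  have "open {z. qpoch_inf z q \<noteq> 0}"
    by (intro open_Collect_neq continuous_intros)
  moreover have "(\<lambda>z. inverse (qpoch_inf z q)) holomorphic_on {z. qpoch_inf z q \<noteq> 0}"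
    by (intro holomorphic_on_inverse qpoch_inf_holomorphic) simp
  ultimately show "holomorphic3_on (\<lambda>p. inverse (qpoch_inf (snd (snd p)) q)) S"
    using nz holomorphic3_on_coordinate(3)[of "\<lambda>z. inverse (qpoch_inf z q)"] by blast
  show "F p = (\<Sum>n. regularized_term n p) / qpoch_inf (snd (snd p)) q" if "p \<in> S" for p
    using that F S(2) summable_lhs_term(2) by (cases p) (auto simp: subset_iff)
qed (use S open_param_region in \<open>auto simp: lhs_domain_eq\<close>)

end

theorem theorem4p2:
  fixes q :: complex and R :: real and f :: "complex \<Rightarrow> complex"
  assumes "0 < norm q" and "norm q < 1"
    and "R > 1"
    and "f holomorphic_on ball 0 R"
  shows "(\<forall>a b c. (a, b, c) \<in> lhs_domain q R \<inter> rhs_domain q R \<longrightarrow>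
            jackson_integrable q (c / (a * b)) 1 (rhs_integrand q f a b c) \<and>
            lhs_term q f a b c sums rhs q f a b c) \<and>
         (\<forall>a b c. (a, b, c) \<in> lhs_domain q R \<longrightarrow> summable (lhs_term q f a b c)) \<and>
         meromorphic3_on (\<lambda>(a, b, c). \<Sum>n. lhs_term q f a b c n)
           (lhs_domain q R) (param_region R) \<and>
         meromorphic3_on (\<lambda>(a, b, c). rhs q f a b c)
           (rhs_domain q R) (param_region R)"
proof -
  interpret q_taylor q R f
    using assms by unfold_locales
  have "param_region R \<subseteq> closure (lhs_domain q R)"
    using param_region_subset_closure closure_mono[OF rhs_domain_subset] by blast
  then have "meromorphic3_on (\<lambda>(a, b, c). \<Sum>n. lhs_term q f a b c n) (lhs_domain q R) (param_region R)"
    by (intro meromorphic_lhs_on open_lhs_domain) auto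
  moreover have "meromorphic3_on (\<lambda>(a, b, c). rhs q f a b c) (rhs_domain q R) (param_region R)"
    using lhs_sums_rhs(2)
    by (intro meromorphic_lhs_on open_rhs_domain rhs_domain_subset param_region_subset_closure)
      (auto simp: sums_iff)
  ultimately show ?thesis
    using lhs_sums_rhs summable_lhs_term(1) by blast
qed

end
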